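(* There exist universal constants $\varepsilon,C>0$ such that the following holds. Let $u\ge 0$ in $\mathbb{R}^n$ satisfy $$\mathcal{M}^-_{\mathcal{L}}u\le f\quad\text{in the viscosity sense in } B_1 .$$ Then for every $t>0$, $$\frac{|\{u>t\}\cap B_{1/4}|}{|B_{1/4}|}\le C\left(\|f^+\|_\infty+\inf_{B_{1/2}}u\right)^{\varepsilon}t^{-\varepsilon}.$$
   Context: Notation: $B_r(x)=\{y\in\mathbb{R}^n:|y-x|<r\}$, $B_r=B_r(0)$, $\chi_A$ is the characteristic function of $A$, $|A|$ is Lebesgue measure, $f:B_1\to\mathbb{R}$ is a function, $f^+=\max(f,0)$, $\|f^+\|_\infty=\sup_{B_1}f^+$, and $\omega_\sigma(dy)=\min(|y|^{-(n+\sigma)},1)\,dy$. $L^1(\omega_\sigma)$ is the set of functions on $\mathbb{R}^n$ integrable with respect to $\omega_\sigma$. Linear operators. Fix $1\le\sigma<2$, $0<\lambda\le\Lambda$, $\beta>0$. For a kernel $K:\mathbb{R}^n\to\mathbb{R}$, $$L_Ku(x)=\int_{\mathbb{R}^n}\big(u(x+y)-u(x)-Du(x)\cdot y\,\chi_{B_1}(y)\big)K(y)\,dy .$$ Let $K^-(y)=\lambda(2-\sigma)|y|^{-(n+\sigma)}\chi_{B_1}(y)$ and $K^+(y)=\Lambda(2-\sigma)|y|^{-(n+\sigma)}$. $\mathcal{K}$ is a family of kernels with $K^-\le K\le K^+$ for every $K\in\mathcal{K}$. $\mathcal{L}$ is a family of operators, each of the form $L=L_K+b\cdot D$ with $K\in\mathcal{K}$,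 $b\in\mathbb{R}^n$, satisfying $$r^{\sigma-1}\left|b+\int_{B_1\setminus B_r}yK(y)\,dy\right|\le\beta\quad\text{for every } r\in(0,1).$$ (In particular $\mathcal{L}$ may be the family of all such operators.) The extremal operator is $\mathcal{M}^-_{\mathcal{L}}u(x)=\inf_{L\in\mathcal{L}}Lu(x)$. Viscosity sense. A test function at $x_0$ is a pair $(\varphi,B_r(x_0))$, $r>0$, with $\varphi\in C^2(B_r(x_0))\cap L^1(\omega_\sigma)$. It touches $u$ from below at $x_0\in\Omega$ if $\varphi(x_0)=u(x_0)$ and $\varphi\le u$ in $\mathbb{R}^n$. A function $u\in L^1(\omega_\sigma)$, lower semicontinuous in $\Omega$, satisfies $\mathcal{M}^-_{\mathcal{L}}u\le f$ in the viscosity sense in $\Omega$ if $\mathcal{M}^-_{\mathcal{L}}\varphi(x_0)\le f(x_0)$ for every test function $\varphi$ touching $u$ from below at a point $x_0\in\Omega$. A constant is universal if it depends only on $n,\lambda,\Lambda,\beta$ (not on $\sigma\in[1,2)$, $\mathcal{L}$, $u$, $f$). *)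

theory Defs
  imports "HOL-Analysis.Analysis"
begin

text \<open>The space \<open>R^n\<close> is \<^typ>\<open>real^'n\<close> with \<open>n = CARD('n)\<close>. Since \<open>0 powr a = 0\<close>, the
  functions of \<open>|y|\<close> below take a wrong value at \<open>y = 0\<close>; as integrands or densities they are
  unaffected, and the pointwise bounds on kernels are required only for \<open>y \<noteq> 0\<close>.\<close>

definition omega :: "real \<Rightarrow> (real^'n) measure" where
  "omega \<sigma> = density lebesgue
     (\<lambda>y. ennreal (min (norm y powr (- (real CARD('n) + \<sigma>))) 1))"

definition in_L1_omega :: "real \<Rightarrow> (real^'n \<Rightarrow> real) \<Rightarrow> bool" where
  "in_L1_omega \<sigma> u \<longleftrightarrow> integrable (omega \<sigma>) u"

definition K_minus :: "real \<Rightarrow> real \<Rightarrow> real^'n \<Rightarrow> real" where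
  "K_minus \<sigma> lam y =
     lam * (2 - \<sigma>) * norm y powr (- (real CARD('n) + \<sigma>)) * indicator (ball 0 1) y"

definition K_plus :: "real \<Rightarrow> real \<Rightarrow> real^'n \<Rightarrow> real" where
  "K_plus \<sigma> Lam y = Lam * (2 - \<sigma>) * norm y powr (- (real CARD('n) + \<sigma>))"

definition kernel_family :: "real \<Rightarrow> real \<Rightarrow> real \<Rightarrow> (real^'n \<Rightarrow> real) set \<Rightarrow> bool" where
  "kernel_family \<sigma> lam Lam \<K> \<longleftrightarrow>
     (\<forall>K\<in>\<K>. K \<in> borel_measurable lebesgue \<and>
        (\<forall>y. y \<noteq> 0 \<longrightarrow> K_minus \<sigma> lam y \<le> K y \<and> K y \<le> K_plus \<sigma> Lam y))"

text \<open>\<open>frechet_derivative u (at x) y\<close> is \<open>Du(x) \<cdot> y\<close>.\<close>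

definition nonlocal_op :: "(real^'n \<Rightarrow> real) \<Rightarrow> (real^'n \<Rightarrow> real) \<Rightarrow> real^'n \<Rightarrow> real" where
  "nonlocal_op K u x =
     (\<integral>y. (u (x + y) - u x - frechet_derivative u (at x) y * indicator (ball 0 1) y) * K y
        \<partial>lebesgue)"

definition drift_op ::
  "(real^'n \<Rightarrow> real) \<Rightarrow> real^'n \<Rightarrow> (real^'n \<Rightarrow> real) \<Rightarrow> real^'n \<Rightarrow> real" where
  "drift_op K b u x = nonlocal_op K u x + frechet_derivative u (at x) b"

definition drift_bound :: "real \<Rightarrow> real \<Rightarrow> (real^'n \<Rightarrow> real) \<Rightarrow> real^'n \<Rightarrow> bool" where
  "drift_bound \<sigma> \<beta> K b \<longleftrightarrow>
     (\<forall>r\<in>{0<..<1}.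
        r powr (\<sigma> - 1) * norm (b + (LINT y:(ball 0 1 - ball 0 r)|lebesgue. K y *\<^sub>R y)) \<le> \<beta>)"

definition operator_family ::
  "real \<Rightarrow> real \<Rightarrow> (real^'n \<Rightarrow> real) set \<Rightarrow> ((real^'n \<Rightarrow> real) \<Rightarrow> real^'n \<Rightarrow> real) set \<Rightarrow> bool" where
  "operator_family \<sigma> \<beta> \<K> \<L> \<longleftrightarrow>
     (\<forall>L\<in>\<L>. \<exists>K\<in>\<K>. \<exists>b. L = drift_op K b \<and> drift_bound \<sigma> \<beta> K b)"

text \<open>The infimum is taken in the extended reals, so that no convention for unbounded or empty
  sets of reals enters.\<close>

definition extremal_minus ::
  "((real^'n \<Rightarrow> real) \<Rightarrow> real^'n \<Rightarrow> real) set \<Rightarrow> (real^'n \<Rightarrow> real) \<Rightarrow> real^'n \<Rightarrow> ereal" where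
  "extremal_minus \<L> u x = (INF L\<in>\<L>. ereal (L u x))"

text \<open>\<open>C\<^sup>2\<close> regularity on an open set, with \<open>D\<close> and \<open>D2\<close> the first and second derivatives.\<close>

definition C2_on :: "('a::real_normed_vector) set \<Rightarrow> ('a \<Rightarrow> real) \<Rightarrow> bool" where
  "C2_on S \<phi> \<longleftrightarrow>
     (\<exists>(D :: 'a \<Rightarrow> 'a \<Rightarrow>\<^sub>L real) (D2 :: 'a \<Rightarrow> 'a \<Rightarrow>\<^sub>L ('a \<Rightarrow>\<^sub>L real)).
        (\<forall>x\<in>S. (\<phi> has_derivative blinfun_apply (D x)) (at x)) \<and>
        (\<forall>x\<in>S. (D has_derivative blinfun_apply (D2 x)) (at x)) \<and>
        continuous_on S D2)"

definition test_function :: "real \<Rightarrow> (real^'n \<Rightarrow> real) \<Rightarrow> real^'n \<Rightarrow> real \<Rightarrow> bool" where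
  "test_function \<sigma> \<phi> x0 r \<longleftrightarrow> 0 < r \<and> C2_on (ball x0 r) \<phi> \<and> in_L1_omega \<sigma> \<phi>"

definition touches_below :: "(real^'n \<Rightarrow> real) \<Rightarrow> (real^'n \<Rightarrow> real) \<Rightarrow> real^'n \<Rightarrow> bool" where
  "touches_below \<phi> u x0 \<longleftrightarrow> \<phi> x0 = u x0 \<and> (\<forall>x. \<phi> x \<le> u x)"

definition lower_semicontinuous_on :: "'a::topological_space set \<Rightarrow> ('a \<Rightarrow> real) \<Rightarrow> bool" where
  "lower_semicontinuous_on S u \<longleftrightarrow>
     (\<forall>x\<in>S. \<forall>a. a < u x \<longrightarrow> (\<forall>\<^sub>F y in at x within S. a < u y))"

definition viscosity_supersolution ::
  "real \<Rightarrow> ((real^'n \<Rightarrow> real) \<Rightarrow> real^'n \<Rightarrow> real) set \<Rightarrow> (real^'n) set \<Rightarrow>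
   (real^'n \<Rightarrow> real) \<Rightarrow> (real^'n \<Rightarrow> real) \<Rightarrow> bool" where
  "viscosity_supersolution \<sigma> \<L> \<Omega> u f \<longleftrightarrow>
     in_L1_omega \<sigma> u \<and> lower_semicontinuous_on \<Omega> u \<and>
     (\<forall>x0\<in>\<Omega>. \<forall>\<phi> r. test_function \<sigma> \<phi> x0 r \<and> touches_below \<phi> u x0 \<longrightarrow>
        extremal_minus \<L> \<phi> x0 \<le> ereal (f x0))"

text \<open>Powers of extended nonnegative reals with exponent \<open>p > 0\<close>; \<open>f\<close> may be unbounded above,
  so the norm of its positive part can be infinite.\<close>

definition ennreal_powr :: "ennreal \<Rightarrow> real \<Rightarrow> ennreal" where
  "ennreal_powr x p = (if x = top then top else ennreal (enn2real x powr p))"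

definition sup_pos :: "'a set \<Rightarrow> ('a \<Rightarrow> real) \<Rightarrow> ennreal" where
  "sup_pos S f = (SUP x\<in>S. ennreal (max (f x) 0))"

end

theory Submission
  imports Defs
begin

text \<open>
  Everything follows from one measure statement that holds at every scale: if \<open>u \<le> m\<close> at some point
  of a closed ball \<open>B\<close> inside \<open>B\<^bsub>1/2\<^esub>\<close> and \<open>f \<le> m\<close>, then \<open>{u \<le> M' m}\<close> fills a fixed fraction of that same
  ball \<open>B\<close> (\<open>low_set_density\<close>). A covering of \<open>{u > m}\<close> by balls that are contained in it and touch
  \<open>{u \<le> m}\<close> then gives \<open>|{u > M' m}| \<le> (1 - c) |{u > m}|\<close> within \<open>B\<^bsub>1/2\<^esub>\<close> (\<open>superlevel_shrinks\<close>), and the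
  iteration of this inequality is the power decay.

  To prove the measure statement, paraboloids of opening \<open>A\<close> are slid from below until they touch \<open>u\<close>.
  At a contact point \<open>x0\<close> the equation is tested with the function that is the paraboloid \<open>P\<close> close to
  \<open>x0\<close>, a truncation of \<open>u\<close> up to distance \<open>\<rho>\<close>, and zero farther away; it lies below \<open>u\<close> because
  \<open>u \<ge> 0\<close>. This bounds the integral of \<open>(u - P) K\<close> over the ball of radius \<open>\<rho>\<close> by \<open>C A \<rho>\<^bsup>2-\<sigma>\<^esup>\<close>
  (\<open>contact_energy\<close>). If \<open>u - P\<close> exceeded \<open>M A r\<^sup>2\<close> on a fixed fraction of each annulus of radius
  \<open>r = \<rho> / 40\<^sup>k\<close>, the integral would be at least \<open>c M A\<close> times the sum of \<open>(2 - \<sigma>) r\<^bsup>2-\<sigma>\<^esup>\<close>, and this sum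
  stays above \<open>\<rho>\<^bsup>2-\<sigma>\<^esup> / 80\<close> as \<open>\<sigma>\<close> tends to \<open>2\<close>. So there is a radius \<open>r \<le> \<rho>\<close> for which \<open>u \<le> P + M A r\<^sup>2\<close>
  on most of the annulus (\<open>supersolution_has_flat_annuli\<close>). This is the only use of the equation, and the
  constants do not depend on \<open>\<sigma>\<close>.

  A flat annulus has two consequences. There are many low points of \<open>u\<close> at distance about \<open>r / 20\<close> from \<open>x0\<close>.
  And the vertices of all paraboloids that touch \<open>u\<close> within \<open>r / 4\<close> of \<open>x0\<close> lie within \<open>4 M r\<close> of the
  vertex of \<open>P\<close>: the difference of two paraboloids of equal opening is affine, and it is controlled on the
  annulus (\<open>vertices_of_near_contacts_close\<close>). By Vitali's lemma the volume of the set of vertices is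
  bounded by that of the low set, with a constant that depends neither on \<open>A\<close> nor on the choice of
  the vertices.

  The point where \<open>u \<le> m\<close> may lie on the boundary of the ball \<open>B\<close>, of centre \<open>z\<close> and radius \<open>\<rho>\<close>, and the
  low set so obtained could lie outside \<open>B\<close>. The vertices are therefore taken in a ball of radius \<open>\<delta> \<rho>\<close>
  around the midpoint between \<open>z\<close> and that point. The contact points then leave \<open>B\<close> by at most
  \<open>3 \<delta>\<^sup>2 \<rho>\<close>, and only within \<open>5 \<delta> \<rho>\<close> of the given point (\<open>contact_point_location\<close>). The part of the low set
  outside \<open>B\<close> is thus in a cap of volume \<open>O(\<delta>\<^bsup>n+1\<^esup> \<rho>\<^sup>n)\<close>, whereas the low set has volume at least \<open>c \<delta>\<^sup>n \<rho>\<^sup>n\<close>,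
  and a small \<open>\<delta>\<close> leaves a definite part inside \<open>B\<close>. This needs the radii \<open>r\<close> to be below \<open>12 \<delta>\<^sup>2 \<rho>\<close>; if
  one of them is larger, its annulus alone has enough low points in \<open>B\<close>.
\<close>

section \<open>Balls, superlevel sets and radial integrals\<close>

abbreviation vol :: "'a::euclidean_space itself \<Rightarrow> real" where
  "vol _ \<equiv> unit_ball_vol (real DIM('a))"

lemma emeasure_lebesgue_ball:
  fixes c :: "'a::euclidean_space"
  assumes "0 \<le> r"
  shows "emeasure lebesgue (ball c r) = ennreal (vol TYPE('a) * r ^ DIM('a))"
  using emeasure_ball[OF assms, of c] by simp

lemma emeasure_lebesgue_cball:
  fixes c :: "'a::euclidean_space"
  assumes "0 \<le> r"
  shows "emeasure lebesgue (cball c r) = ennreal (vol TYPE('a) * r ^ DIM('a))"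
  using emeasure_cball[OF assms, of c] by simp

lemma measure_lebesgue_cball:
  fixes c :: "'a::euclidean_space"
  assumes "0 \<le> r"
  shows "measure lebesgue (cball c r) = vol TYPE('a) * r ^ DIM('a)"
  using content_cball[OF assms, of c] by simp

lemma superlevel_lmeasurable:
  fixes u :: "'a::euclidean_space \<Rightarrow> real"
  assumes u: "u \<in> borel_measurable lebesgue" and D: "D \<in> lmeasurable"
  shows "{x \<in> D. t < u x} \<in> lmeasurable" "{x \<in> D. u x \<le> t} \<in> lmeasurable"
proof -
  have "{x\<in>space lebesgue. t < u x} \<in> sets lebesgue" "{x\<in>space lebesgue. u x \<le> t} \<in> sets lebesgue"
    using u by measurable
  then have "D \<inter> {x. t < u x} \<in> lmeasurable" "D \<inter> {x. u x \<le> t} \<in> lmeasurable"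
    using D by (auto intro!: fmeasurable_Int_fmeasurable)
  then show "{x \<in> D. t < u x} \<in> lmeasurable" "{x \<in> D. u x \<le> t} \<in> lmeasurable"
    by (simp_all only: Collect_conj_eq Collect_mem_eq)
qed

text \<open>Radial integrands are dominated by a step function whose steps are balls. Summing over balls instead
  of shells avoids polar coordinates at the price of a constant.\<close>

lemma nn_integral_le_sum_over_balls:
  fixes g :: "'a::euclidean_space \<Rightarrow> ennreal" and R c :: "nat \<Rightarrow> real"
  assumes dom: "\<And>y. g y \<noteq> 0 \<Longrightarrow> \<exists>k. norm y < R k \<and> g y \<le> ennreal (c k)"
    and nonneg: "\<And>k. 0 \<le> R k" "\<And>k. 0 \<le> c k"
    and sums: "(\<lambda>k. c k * (vol TYPE('a) * R k ^ DIM('a))) sums S"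
  shows "(\<integral>\<^sup>+y. g y \<partial>lebesgue) \<le> ennreal S"
proof -
  have "(\<integral>\<^sup>+y. g y \<partial>lebesgue)
      \<le> (\<integral>\<^sup>+y. (\<Sum>k. ennreal (c k) * indicator (ball 0 (R k)) y) \<partial>(lebesgue :: 'a measure))"
  proof (rule nn_integral_mono)
    fix y :: 'a
    show "g y \<le> (\<Sum>k. ennreal (c k) * indicator (ball 0 (R k)) y)"
    proof (cases "g y = 0")
      case False
      then obtain k where k: "norm y < R k" "g y \<le> ennreal (c k)" using dom by blast
      have "h k \<le> (\<Sum>k. h k)" for h :: "nat \<Rightarrow> ennreal"
        using sum_le_suminf[of h "{k}"] by simp
      from this[of "\<lambda>k. ennreal (c k) * indicator (ball 0 (R k)) y"]
      have "ennreal (c k) * indicator (ball 0 (R k)) y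
          \<le> (\<Sum>k. ennreal (c k) * indicator (ball 0 (R k)) y)" .
      with k show ?thesis by simp
    qed simp
  qed
  also have "\<dots> = (\<Sum>k. \<integral>\<^sup>+y. ennreal (c k) * indicator (ball 0 (R k)) y \<partial>(lebesgue :: 'a measure))"
    by (rule nn_integral_suminf)
      (intro borel_measurable_times_ennreal borel_measurable_const borel_measurable_indicator, simp)
  also have "\<dots> = (\<Sum>k. ennreal (c k * (vol TYPE('a) * R k ^ DIM('a))))"
    by (simp add: nn_integral_cmult_indicator emeasure_ball nonneg ennreal_mult)
  also have "\<dots> = ennreal S"
    by (rule suminf_ennreal_eq) (use nonneg sums in auto)
  finally show ?thesis .
qed

text \<open>Convexity of the exponential: on \<open>[0, 1]\<close> the function \<open>2\<^bsup>-a\<^esup>\<close> lies below its chord \<open>1 - a / 2\<close>. The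
  ratio of the geometric series below is \<open>2\<^bsup>-(2-\<sigma>)\<^esup>\<close>, and its sum is of order \<open>1 / (2 - \<sigma>)\<close>.\<close>

lemma half_le_one_minus_two_powr:
  fixes a :: real
  assumes "0 < a" "a \<le> 1"
  shows "a / 2 \<le> 1 - 2 powr (-a)"
proof -
  have "convex_on UNIV (\<lambda>x::real. exp x)"
    by (rule exp_convex)
  then have "exp ((1 - a) *\<^sub>R 0 + a *\<^sub>R (- ln 2)) \<le> (1 - a) * exp 0 + a * exp (- ln (2::real))"
    by (rule convex_onD) (use assms in auto)
  moreover have "exp (- ln (2::real)) = 1/2" by (simp add: exp_minus)
  ultimately show ?thesis by (simp add: powr_def field_simps)
qed

lemma dyadic_scale_inside:
  fixes t \<rho> :: real
  assumes "0 < t" "t < \<rho>"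
  shows "\<exists>k. t < \<rho> * (1/2)^k \<and> \<rho> * (1/2)^Suc k \<le> t"
proof -
  obtain N where N: "(1/2::real)^N < t / \<rho>"
    using real_arch_pow_inv[of "t/\<rho>" "1/2"] assms by auto
  define j where "j = (LEAST j. \<rho> * (1/2)^j \<le> t)"
  have ex: "\<rho> * (1/2)^N \<le> t" using N assms by (simp add: field_simps)
  have j: "\<rho> * (1/2)^j \<le> t" unfolding j_def using ex by (rule LeastI)
  have "j \<noteq> 0" using j assms by (cases j) auto
  then obtain k where k: "j = Suc k" by (cases j) auto
  have "\<not> \<rho> * (1/2)^k \<le> t"
    using not_less_Least[of k "\<lambda>j. \<rho> * (1/2)^j \<le> t"] k j_def by simp
  with j k show ?thesis by (intro exI[of _ k]) auto
qed

lemma geometric_scale: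
  fixes t \<rho> b :: real
  assumes "0 < \<rho>" "\<rho> \<le> t" "1 < b"
  shows "\<exists>k. \<rho> * b^k \<le> t \<and> t < \<rho> * b^Suc k"
proof -
  obtain N where N: "t / \<rho> < b^N"
    using real_arch_pow[of b "t/\<rho>"] assms by auto
  define j where "j = (LEAST j. t < \<rho> * b^j)"
  have ex: "t < \<rho> * b^N" using N assms by (simp add: field_simps)
  have j: "t < \<rho> * b^j" unfolding j_def using ex by (rule LeastI)
  have "j \<noteq> 0" using j assms by (cases j) auto
  then obtain k where k: "j = Suc k" by (cases j) auto
  have "\<not> t < \<rho> * b^k"
    using not_less_Least[of k "\<lambda>j. t < \<rho> * b^j"] k j_def by simp
  with j k show ?thesis by (intro exI[of _ k]) auto
qed

text \<open>The factor \<open>1 / (2 - \<sigma>)\<close> cancels the factor \<open>2 - \<sigma>\<close> of the kernels, so the second moment of a kernel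
  is bounded uniformly in \<open>\<sigma> < 2\<close>.\<close>

lemma nn_integral_norm_powr_inside:
  fixes \<sigma> \<rho> :: real
  assumes s: "1 \<le> \<sigma>" "\<sigma> < 2" and r: "0 < \<rho>"
  shows "(\<integral>\<^sup>+y. ennreal (norm y powr (2 - (real DIM('a) + \<sigma>)) * indicator (ball 0 \<rho>) y)
            \<partial>(lebesgue :: 'a::euclidean_space measure))
          \<le> ennreal (2 ^ (DIM('a) + 1) * vol TYPE('a) / (2 - \<sigma>) * \<rho> powr (2 - \<sigma>))"
proof -
  define n where "n = DIM('a)"
  define e where "e = 2 - (real n + \<sigma>)"
  have n: "1 \<le> n" unfolding n_def using DIM_positive[where 'a='a] by linarith
  have e: "e \<le> 0" "- e \<le> n" unfolding e_def using n s by auto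
  define R where "R k = \<rho> * (1/2)^k" for k
  define c where "c k = (\<rho> * (1/2)^Suc k) powr e" for k
  define q where "q = 2 powr (-(2 - \<sigma>))"
  have q: "0 \<le> q" "q < 1" "(2 - \<sigma>) / 2 \<le> 1 - q"
    using half_le_one_minus_two_powr[of "2 - \<sigma>"] s unfolding q_def by (auto simp: powr_less_one)
  define V where "V = vol TYPE('a)"
  have V: "0 \<le> V" unfolding V_def by simp
  define W where "W = V * (2 powr (- e) * \<rho> powr (2 - \<sigma>))"
  have eq: "c k * (V * R k ^ n) = W * q ^ k" for k
  proof -
    have R0: "0 < R k" using r by (simp add: R_def)
    have "c k = (R k * (1/2)) powr e" unfolding c_def R_def by (simp add: mult_ac)
    also have "\<dots> = R k powr e * 2 powr (- e)" using R0
      by (simp add: powr_mult powr_divide powr_minus field_simps)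
    finally have c: "c k = R k powr e * 2 powr (- e)" .
    have "R k powr e * R k ^ n = R k powr (2 - \<sigma>)"
      using R0 by (simp add: powr_realpow[symmetric] powr_add[symmetric] e_def)
    also have "\<dots> = \<rho> powr (2 - \<sigma>) * q ^ k"
    proof -
      have "((1/2::real)^k) powr (2 - \<sigma>) = q ^ k"
      proof -
        have "(1/2::real)^k = 2 powr (- real k)" by (simp add: powr_minus powr_realpow power_divide inverse_eq_divide)
        then show ?thesis unfolding q_def by (simp add: powr_powr powr_power algebra_simps)
      qed
      then show ?thesis using r unfolding R_def by (simp add: powr_mult)
    qed
    finally show ?thesis by (simp add: c W_def mult_ac)
  qed
  have "(\<integral>\<^sup>+y. ennreal (norm y powr e * indicator (ball 0 \<rho>) y) \<partial>(lebesgue :: 'a measure))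
      \<le> ennreal (W * (1 / (1 - q)))"
  proof (rule nn_integral_le_sum_over_balls)
    fix y :: 'a
    assume "ennreal (norm y powr e * indicator (ball 0 \<rho>) y) \<noteq> 0"
    then have y: "0 < norm y" "norm y < \<rho>" by (auto split: split_indicator_asm)
    obtain k where k: "norm y < \<rho> * (1/2)^k" "\<rho> * (1/2)^Suc k \<le> norm y"
      using dyadic_scale_inside[OF y] by blast
    have "norm y powr e \<le> c k" unfolding c_def
      by (rule powr_mono2') (use e k r in auto)
    then have "ennreal (norm y powr e * indicator (ball 0 \<rho>) y) \<le> ennreal (c k)"
      using y by (simp add: ennreal_leI)
    then show "\<exists>k. norm y < R k \<and> ennreal (norm y powr e * indicator (ball 0 \<rho>) y) \<le> ennreal (c k)"
      using k R_def by auto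
  next
    show "(\<lambda>k. c k * (vol TYPE('a) * R k ^ DIM('a))) sums (W * (1 / (1 - q)))"
      using eq sums_mult[OF geometric_sums[of q], of W] q unfolding V_def n_def by simp
  qed (use r in \<open>auto simp: R_def c_def\<close>)
  also have "W * (1 / (1 - q)) \<le> 2 ^ (n + 1) * V / (2 - \<sigma>) * \<rho> powr (2 - \<sigma>)"
  proof -
    have "1 / (1 - q) \<le> 2 / (2 - \<sigma>)" using q s by (simp add: field_simps)
    moreover have "W \<le> V * (2 ^ n * \<rho> powr (2 - \<sigma>))"
    proof -
      have "(2::real) powr (- e) \<le> 2 powr n" by (rule powr_mono) (use e in auto)
      then show ?thesis unfolding W_def using V by (intro mult_left_mono mult_right_mono) (auto simp: powr_realpow)
    qed
    ultimately have "W * (1 / (1 - q)) \<le> V * (2 ^ n * \<rho> powr (2 - \<sigma>)) * (2 / (2 - \<sigma>))"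
      using V q by (intro mult_mono) (auto simp: W_def)
    then show ?thesis by (simp add: field_simps)
  qed
  finally show ?thesis unfolding e_def n_def V_def by (simp add: ennreal_leI)
qed

lemma nn_integral_norm_powr_outside:
  fixes \<sigma> \<rho> :: real
  assumes s: "1 \<le> \<sigma>" and r: "0 < \<rho>"
  shows "(\<integral>\<^sup>+y. ennreal (norm y powr (- (real DIM('a) + \<sigma>)) * indicator (- ball 0 \<rho>) y)
            \<partial>(lebesgue :: 'a::euclidean_space measure))
          \<le> ennreal (2 ^ (DIM('a) + 1) * vol TYPE('a) * \<rho> powr (- \<sigma>))"
proof -
  define n where "n = DIM('a)"
  define e where "e = - (real n + \<sigma>)"
  define R where "R k = \<rho> * 2^Suc k" for k
  define c where "c k = (\<rho> * 2^k) powr e" for k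
  define q where "q = 2 powr (-\<sigma>)"
  have q: "0 \<le> q" "q \<le> 1/2"
  proof -
    have "q \<le> 2 powr (-1)" unfolding q_def by (rule powr_mono) (use s in auto)
    then show "q \<le> 1/2" by simp
  qed (simp add: q_def)
  define V where "V = vol TYPE('a)"
  have V: "0 \<le> V" unfolding V_def by simp
  define W where "W = V * (2 ^ n * \<rho> powr (- \<sigma>))"
  have eq: "c k * (V * R k ^ n) = W * q ^ k" for k
  proof -
    define t where "t = \<rho> * 2^k"
    have t: "0 < t" using r by (simp add: t_def)
    have "t powr e * t ^ n = t powr (- \<sigma>)"
      using t by (simp add: powr_realpow[symmetric] powr_add[symmetric] e_def)
    also have "\<dots> = \<rho> powr (- \<sigma>) * q ^ k"
    proof -
      have "((2::real)^k) powr (- \<sigma>) = q ^ k"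
        unfolding q_def by (simp add: powr_realpow[symmetric] powr_powr powr_power mult_ac)
      then show ?thesis using r unfolding t_def by (simp add: powr_mult)
    qed
    finally have "t powr e * t ^ n = \<rho> powr (- \<sigma>) * q ^ k" .
    moreover have "c k = t powr e" "R k ^ n = 2 ^ n * t ^ n"
      by (simp_all add: c_def t_def R_def power_mult_distrib)
    ultimately show ?thesis by (simp add: W_def mult_ac)
  qed
  have "(\<integral>\<^sup>+y. ennreal (norm y powr e * indicator (- ball 0 \<rho>) y) \<partial>(lebesgue :: 'a measure))
      \<le> ennreal (W * (1 / (1 - q)))"
  proof (rule nn_integral_le_sum_over_balls)
    fix y :: 'a
    assume "ennreal (norm y powr e * indicator (- ball 0 \<rho>) y) \<noteq> 0"
    then have y: "\<rho> \<le> norm y" by (auto split: split_indicator_asm)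
    obtain k where k: "\<rho> * 2^k \<le> norm y" "norm y < \<rho> * 2^Suc k"
      using geometric_scale[OF r y, of 2] by auto
    have "norm y powr e \<le> c k" unfolding c_def
      by (rule powr_mono2') (use k r s in \<open>auto simp: e_def\<close>)
    then have "ennreal (norm y powr e * indicator (- ball 0 \<rho>) y) \<le> ennreal (c k)"
      using y by (simp add: ennreal_leI)
    then show "\<exists>k. norm y < R k \<and> ennreal (norm y powr e * indicator (- ball 0 \<rho>) y) \<le> ennreal (c k)"
      using k R_def by auto
  next
    show "(\<lambda>k. c k * (vol TYPE('a) * R k ^ DIM('a))) sums (W * (1 / (1 - q)))"
      using eq sums_mult[OF geometric_sums[of q], of W] q unfolding V_def n_def by simp
  qed (use r in \<open>auto simp: R_def c_def\<close>)
  also have "W * (1 / (1 - q)) \<le> 2 ^ (n + 1) * V * \<rho> powr (- \<sigma>)"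
  proof -
    have "1 / (1 - q) \<le> 2" using q by (simp add: field_simps)
    then have "W * (1 / (1 - q)) \<le> W * 2"
      using V by (intro mult_left_mono) (auto simp: W_def)
    then show ?thesis by (simp add: W_def mult_ac)
  qed
  finally show ?thesis unfolding e_def n_def V_def by (simp add: ennreal_leI)
qed

section \<open>A covering inequality and the volume of a cap\<close>

text \<open>The form in which Vitali's lemma is used: the sets \<open>B i\<close> are the enlarged balls, or balls
  around the vertices that belong to them, and the \<open>G i\<close> are parts of the disjoint small balls.\<close>

lemma emeasure_cover_le:
  assumes C: "countable C" and B: "\<And>i. i \<in> C \<Longrightarrow> B i \<in> sets M"
    and G: "\<And>i. i \<in> C \<Longrightarrow> G i \<in> sets M" and disj: "disjoint_family_on G C"
    and le: "\<And>i. i \<in> C \<Longrightarrow> emeasure M (B i) \<le> K * emeasure M (G i)"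
    and A: "A \<subseteq> (\<Union>i\<in>C. B i)"
  shows "emeasure M A \<le> K * emeasure M (\<Union>i\<in>C. G i)"
proof -
  define f where "f = to_nat_on C"
  have inj: "inj_on f C" unfolding f_def using C by (rule inj_on_to_nat_on)
  define B' where "B' k = (\<Union>i\<in>{i\<in>C. f i = k}. B i)" for k
  define G' where "G' k = (\<Union>i\<in>{i\<in>C. f i = k}. G i)" for k
  have single: "{i\<in>C. f i = k} = {} \<or> (\<exists>i\<in>C. {i\<in>C. f i = k} = {i})" for k
    using inj unfolding inj_on_def by blast
  have B'_sets: "B' k \<in> sets M" for k
    using B C unfolding B'_def by (intro sets.countable_UN'') (auto intro: countable_subset)
  have G'_sets: "G' k \<in> sets M" for k
    using G C unfolding G'_def by (intro sets.countable_UN'') (auto intro: countable_subset)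
  have le': "emeasure M (B' k) \<le> K * emeasure M (G' k)" for k
    using single[of k]
  proof
    assume "{i\<in>C. f i = k} = {}"
    then show ?thesis unfolding B'_def G'_def by (simp only:) simp
  next
    assume "\<exists>i\<in>C. {i\<in>C. f i = k} = {i}"
    then obtain i where "i \<in> C" "{i\<in>C. f i = k} = {i}" by blast
    then show ?thesis unfolding B'_def G'_def using le by (simp only:) simp
  qed
  have disj': "disjoint_family G'"
    unfolding disjoint_family_on_def
  proof (intro ballI impI)
    fix k l :: nat assume "k \<noteq> l"
    then show "G' k \<inter> G' l = {}"
      using disj unfolding G'_def disjoint_family_on_def by fastforce
  qed
  have "(\<Union>i\<in>C. B i) = (\<Union>k. B' k)" "(\<Union>i\<in>C. G i) = (\<Union>k. G' k)"
    unfolding B'_def G'_def by auto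
  note UN = this
  have "emeasure M A \<le> emeasure M (\<Union>k. B' k)"
    using A B'_sets by (intro emeasure_mono) (auto simp: UN)
  also have "\<dots> \<le> (\<Sum>k. emeasure M (B' k))"
    using B'_sets by (intro emeasure_subadditive_countably) auto
  also have "\<dots> \<le> (\<Sum>k. K * emeasure M (G' k))"
    using le' by (intro suminf_le) auto
  also have "\<dots> = K * (\<Sum>k. emeasure M (G' k))" by (rule ennreal_suminf_cmult)
  also have "(\<Sum>k. emeasure M (G' k)) = emeasure M (\<Union>k. G' k)"
    using G'_sets disj' by (intro suminf_emeasure) auto
  finally show ?thesis unfolding UN .
qed

text \<open>The \<open>J\<close> translates of \<open>S\<close> by multiples of \<open>h e\<close> are disjoint and stay in a slightly larger ball.
  This replaces a computation in coordinates adapted to \<open>e\<close>.\<close>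

lemma thin_slab_volume:
  fixes p e :: "'a::euclidean_space"
  assumes e: "norm e = 1" and h: "0 < h" and R: "0 \<le> R"
    and S: "S \<in> lmeasurable" "S \<subseteq> cball p R"
    and slab: "\<And>x. x \<in> S \<Longrightarrow> \<alpha> \<le> x \<bullet> e \<and> x \<bullet> e < \<alpha> + h"
  shows "real J * measure lebesgue S \<le> vol TYPE('a) * (R + real J * h) ^ DIM('a)"
proof -
  define T where "T j = (\<lambda>x. (real j * h) *\<^sub>R e + x) ` S" for j
  have ee: "e \<bullet> e = 1" using e by (simp add: dot_square_norm)
  have Tm: "T j \<in> lmeasurable" "measure lebesgue (T j) = measure lebesgue S" for j
    using S(1) unfolding T_def by (simp_all add: measurable_translation measure_translation)
  have in_slab: "\<alpha> + real j * h \<le> x \<bullet> e \<and> x \<bullet> e < \<alpha> + real (Suc j) * h" if "x \<in> T j" for x j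
    using that slab unfolding T_def by (auto simp: inner_add_left ee algebra_simps)
  have lt: "T i \<inter> T j = {}" if "i < j" for i j
  proof -
    have "real (Suc i) * h \<le> real j * h" using that h by (intro mult_right_mono) auto
    then show ?thesis using in_slab[of _ i] in_slab[of _ j] by fastforce
  qed
  have disj: "disjoint_family_on T {..<J}"
    unfolding disjoint_family_on_def using lt by (metis Int_commute linorder_neqE_nat)
  have "T j \<subseteq> cball p (R + real J * h)" if "j < J" for j
  proof
    fix x assume "x \<in> T j"
    then obtain y where y: "y \<in> S" "x = (real j * h) *\<^sub>R e + y" unfolding T_def by auto
    have "dist p x \<le> dist p y + norm ((real j * h) *\<^sub>R e)"
      using dist_triangle[of p x y] by (simp add: y dist_norm[of y])
    also have "\<dots> \<le> R + real J * h"
      using y S(2) e h that by (intro add_mono) (auto intro!: mult_right_mono)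
    finally show "x \<in> cball p (R + real J * h)" by simp
  qed
  then have sub: "(\<Union>j<J. T j) \<subseteq> cball p (R + real J * h)" by auto
  have "real J * measure lebesgue S = (\<Sum>j<J. measure lebesgue (T j))" by (simp add: Tm)
  also have "\<dots> = measure lebesgue (\<Union>j<J. T j)"
    using Tm disj by (intro measure_finite_Union[symmetric]) (auto simp: fmeasurable_def less_top[symmetric] simp del: emeasure_completion)
  also have "\<dots> \<le> measure lebesgue (cball p (R + real J * h))"
    using sub Tm by (intro measure_mono_fmeasurable) (auto intro!: sets.finite_UN fmeasurableD)
  also have "\<dots> = vol TYPE('a) * (R + real J * h) ^ DIM('a)"
    using R h by (intro measure_lebesgue_cball) auto
  finally show ?thesis .
qed

text \<open>A shell of thickness \<open>4 \<delta>\<^sup>2 \<rho>\<close> around the sphere, cut to distance \<open>6 \<delta> \<rho>\<close> from \<open>xs\<close>, is contained in a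
  slab of thickness \<open>41 \<delta>\<^sup>2 \<rho>\<close> orthogonal to \<open>xs - z\<close>, since the sphere deviates from its tangent plane
  only to second order. With \<open>\<delta> = 1 / (41 J)\<close>, the \<open>J\<close> translates of the slab span a length \<open>\<delta> \<rho>\<close>.\<close>

lemma cap_outside_ball_small:
  fixes z xs :: "'a::euclidean_space"
  assumes xs: "norm (xs - z) \<le> \<rho>" and \<rho>: "0 < \<rho>" and J: "1 \<le> J"
    and \<delta>: "\<delta> = 1 / (41 * real J)"
  obtains Z where "Z \<in> lmeasurable"
    "real J * measure lebesgue Z \<le> vol TYPE('a) * (7 * \<delta> * \<rho>) ^ DIM('a)"
    "\<And>x. \<rho> < norm (x - z) \<Longrightarrow> norm (x - z) \<le> (1 + 4 * \<delta>^2) * \<rho> \<Longrightarrow>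
          norm (x - xs) \<le> 6 * \<delta> * \<rho> \<Longrightarrow> x \<in> Z"
proof (cases "xs = z")
  case True
  have d: "0 < \<delta>" "\<delta> \<le> 1/41" using J unfolding \<delta> by (auto simp: field_simps)
  \<comment> \<open>A point outside the ball has distance more than \<open>\<rho>\<close> from its centre, so no point qualifies.\<close>
  show ?thesis
  proof (rule that[of "{}"])
    fix x :: 'a
    assume "\<rho> < norm (x - z)" "norm (x - xs) \<le> 6 * \<delta> * \<rho>"
    moreover have "6 * \<delta> * \<rho> \<le> \<rho>" using d \<rho> by simp
    ultimately show "x \<in> {}" using True by simp
  qed (use \<rho> d in auto)
next
  case False
  have d: "0 < \<delta>" "\<delta> \<le> 1/41" using J unfolding \<delta> by (auto simp: field_simps)
  define e where "e = sgn (xs - z)"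
  have e: "norm e = 1" using False by (simp add: e_def norm_sgn)
  have ee: "e \<bullet> e = 1" using e by (simp add: dot_square_norm)
  define h where "h = 41 * \<delta>^2 * \<rho>"
  define \<alpha> where "\<alpha> = z \<bullet> e + (1 - 36 * \<delta>^2) * \<rho>"
  define Z where "Z = cball xs (6 * \<delta> * \<rho>) \<inter> {x. \<alpha> \<le> e \<bullet> x} \<inter> {x. e \<bullet> x < \<alpha> + h}"
  have h: "0 < h" using d \<rho> by (simp add: h_def)
  have Z: "Z \<in> lmeasurable"
    unfolding Z_def
  proof (rule bounded_set_imp_lmeasurable)
    show "bounded (cball xs (6 * \<delta> * \<rho>) \<inter> {x. \<alpha> \<le> e \<bullet> x} \<inter> {x. e \<bullet> x < \<alpha> + h})"
      by (meson bounded_Int bounded_cball)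
    have "{x. \<alpha> \<le> e \<bullet> x} \<in> sets borel" "{x. e \<bullet> x < \<alpha> + h} \<in> sets borel"
      using closed_halfspace_ge[of \<alpha> e] open_halfspace_lt[of e "\<alpha> + h"]
      by (auto intro: borel_closed borel_open simp: inner_commute)
    then show "cball xs (6 * \<delta> * \<rho>) \<inter> {x. \<alpha> \<le> e \<bullet> x} \<inter> {x. e \<bullet> x < \<alpha> + h} \<in> sets lebesgue"
      by (intro sets.Int) auto
  qed
  have Jh: "real J * h = \<delta> * \<rho>"
  proof -
    have "real J * (41 * \<delta>) = 1" using J unfolding \<delta> by simp
    then have "real J * (41 * \<delta>) * (\<delta> * \<rho>) = \<delta> * \<rho>" by simp
    then show ?thesis unfolding h_def by (simp add: power2_eq_square mult_ac)
  qed
  show ?thesis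
  proof (rule that[OF Z])
    have "real J * measure lebesgue Z \<le> vol TYPE('a) * (6 * \<delta> * \<rho> + real J * h) ^ DIM('a)"
      by (rule thin_slab_volume[OF e h _ Z, of _ xs \<alpha>]) (use d \<rho> in \<open>auto simp: Z_def inner_commute\<close>)
    then show "real J * measure lebesgue Z \<le> vol TYPE('a) * (7 * \<delta> * \<rho>) ^ DIM('a)"
      unfolding Jh by (simp add: algebra_simps)
  next
    fix x assume x: "\<rho> < norm (x - z)" "norm (x - z) \<le> (1 + 4 * \<delta>^2) * \<rho>"
      "norm (x - xs) \<le> 6 * \<delta> * \<rho>"
    define W where "W = x - z"
    define S where "S = xs - z"
    define a where "a = W \<bullet> e"
    have S: "S = norm S *\<^sub>R e" using False by (simp add: e_def S_def sgn_div_norm)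
    have WS: "norm (W - S) \<le> 6 * \<delta> * \<rho>" using x by (simp add: W_def S_def)
    have Sn: "norm W - 6 * \<delta> * \<rho> \<le> norm S"
      using WS norm_triangle_ineq2[of W S] by linarith
    have upper: "a \<le> (1 + 4 * \<delta>^2) * \<rho>"
      using Cauchy_Schwarz_ineq2[of W e] e x(2) unfolding a_def W_def by simp
    define c where "c = norm S"
    have Sc: "S = c *\<^sub>R e" using S by (simp add: c_def)
    have "(norm (W - c *\<^sub>R e))^2 = (norm W)^2 - 2 * c * a + c^2"
      unfolding a_def power2_norm_eq_inner
      by (simp add: inner_diff_left inner_diff_right ee inner_commute power2_eq_square)
    also have "\<dots> = (norm W)^2 - a^2 + (c - a)^2" by (simp add: power2_eq_square algebra_simps)
    finally have "(norm W)^2 - a^2 \<le> (norm (W - S))^2" unfolding Sc by simp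
    also have "\<dots> \<le> (6 * \<delta> * \<rho>)^2" using WS by (rule power_mono) simp
    finally have sq: "(norm W)^2 - (6 * \<delta> * \<rho>)^2 \<le> a^2" by simp
    have apos: "0 \<le> a"
    proof -
      have "S \<bullet> e = c" unfolding Sc using ee by simp
      then have "S \<bullet> e = norm S" by (simp only: c_def)
      then have "a = norm S + (W - S) \<bullet> e" by (simp add: a_def inner_diff_left)
      moreover have "\<bar>(W - S) \<bullet> e\<bar> \<le> 6 * \<delta> * \<rho>"
        using Cauchy_Schwarz_ineq2[of "W - S" e] e WS by simp
      moreover have "12 * \<delta> * \<rho> \<le> \<rho>" using d \<rho> by simp
      ultimately show ?thesis using Sn x(1) unfolding W_def by linarith
    qed
    have lower: "(1 - 36 * \<delta>^2) * \<rho> \<le> a"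
    proof (rule power2_le_imp_le[OF _ apos])
      have d2: "0 \<le> 36 * \<delta>^2" "36 * \<delta>^2 \<le> 1"
      proof -
        have "\<delta>^2 \<le> (1/41)^2" using d by (intro power_mono) auto
        then show "36 * \<delta>^2 \<le> 1" by (simp add: power2_eq_square)
      qed simp
      then have "(1 - 36 * \<delta>^2)^2 \<le> 1 - 36 * \<delta>^2"
        using mult_left_mono[of "1 - 36 * \<delta>^2" 1 "1 - 36 * \<delta>^2"] by (simp add: power2_eq_square)
      then have "((1 - 36 * \<delta>^2) * \<rho>)^2 \<le> (1 - 36 * \<delta>^2) * \<rho>^2"
        by (simp add: power_mult_distrib mult_right_mono)
      also have "\<dots> = \<rho>^2 - (6 * \<delta> * \<rho>)^2" by (simp add: power2_eq_square algebra_simps)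
      also have "\<dots> \<le> (norm W)^2 - (6 * \<delta> * \<rho>)^2"
        using x(1) \<rho> unfolding W_def by (simp add: power_mono)
      finally show "((1 - 36 * \<delta>^2) * \<rho>)^2 \<le> a^2" using sq by linarith
    qed
    have xe: "e \<bullet> x = z \<bullet> e + a" unfolding a_def W_def by (simp add: inner_diff_left inner_diff_right inner_commute)
    define D where "D = \<delta>^2 * \<rho>"
    have "0 < D" using d \<rho> by (simp add: D_def)
    moreover have "a \<le> \<rho> + 4 * D" "\<rho> - 36 * D \<le> a" using upper lower by (simp_all add: D_def algebra_simps)
    moreover have "\<alpha> = z \<bullet> e + \<rho> - 36 * D" "h = 41 * D" by (simp_all add: \<alpha>_def h_def D_def algebra_simps)
    ultimately have "\<alpha> \<le> e \<bullet> x" "e \<bullet> x < \<alpha> + h" unfolding xe by linarith+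
    moreover have "x \<in> cball xs (6 * \<delta> * \<rho>)" using x(3) by (simp add: dist_norm norm_minus_commute)
    ultimately show "x \<in> Z" unfolding Z_def by blast
  qed
qed

section \<open>Lower semicontinuous functions\<close>

lemma lsc_superlevel_open:
  fixes u :: "'a::topological_space \<Rightarrow> real"
  assumes "open S" "lower_semicontinuous_on S u"
  shows "open {x\<in>S. a < u x}"
proof (subst open_subopen, intro ballI)
  fix x assume x: "x \<in> {x\<in>S. a < u x}"
  then have "\<forall>\<^sub>F y in at x within S. a < u y"
    using assms(2) unfolding lower_semicontinuous_on_def by auto
  then obtain T where T: "open T" "x \<in> T" "\<And>y. y \<in> T \<Longrightarrow> y \<noteq> x \<Longrightarrow> y \<in> S \<Longrightarrow> a < u y"
    unfolding eventually_at_topological by auto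
  show "\<exists>T. open T \<and> x \<in> T \<and> T \<subseteq> {x\<in>S. a < u x}"
    by (rule exI[of _ "T \<inter> S"]) (use T x assms(1) in auto)
qed

lemma lsc_add_continuous:
  fixes u q :: "'a::topological_space \<Rightarrow> real"
  assumes u: "lower_semicontinuous_on S u" and q: "continuous_on S q"
  shows "lower_semicontinuous_on S (\<lambda>x. u x + q x)"
  unfolding lower_semicontinuous_on_def
proof (intro ballI allI impI)
  fix x a assume x: "x \<in> S" and a: "a < u x + q x"
  define \<epsilon> where "\<epsilon> = (u x + q x - a) / 2"
  have \<epsilon>: "0 < \<epsilon>" using a by (simp add: \<epsilon>_def)
  have "\<forall>\<^sub>F y in at x within S. u x - \<epsilon> < u y"
    using u x \<epsilon> unfolding lower_semicontinuous_on_def by auto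
  moreover have "\<forall>\<^sub>F y in at x within S. q x - \<epsilon> < q y"
    using q x \<epsilon> by (intro order_tendstoD(1)[of q "q x"]) (auto simp: continuous_on_def)
  ultimately show "\<forall>\<^sub>F y in at x within S. a < u y + q y"
    by eventually_elim (auto simp: \<epsilon>_def field_simps)
qed

text \<open>If no point were minimal, the sets \<open>{g > g y}\<close> for \<open>y\<close> in \<open>K\<close> would cover \<open>K\<close>, and a finite subcover
  misses the best of its own indices \<open>y\<close>.\<close>

lemma lsc_attains_inf:
  fixes g :: "'a::topological_space \<Rightarrow> real"
  assumes "compact K" "K \<noteq> {}" "K \<subseteq> S" "open S" "lower_semicontinuous_on S g"
  shows "\<exists>x\<in>K. \<forall>y\<in>K. g x \<le> g y"
proof (rule ccontr)
  assume "\<not> ?thesis"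
  then have "K \<subseteq> (\<Union>y\<in>K. {x\<in>S. g y < g x})" using assms(3) by force
  then obtain C where C: "C \<subseteq> K" "finite C" "K \<subseteq> (\<Union>y\<in>C. {x\<in>S. g y < g x})"
    using compactE_image[OF assms(1) lsc_superlevel_open[OF assms(4,5)]] by blast
  have "C \<noteq> {}" using C assms(2) by auto
  then have "Min (g ` C) \<in> g ` C" using C by (intro Min_in) auto
  then obtain y where y: "y \<in> C" "g y = Min (g ` C)" by auto
  then obtain y' where "y' \<in> C" "g y' < g y" using C by blast
  then show False using y C(2) by (metis Min_le finite_imageI imageI not_le)
qed

section \<open>Paraboloids sliding from below\<close>

text \<open>The concave paraboloid with Hessian \<open>-A\<close> and vertex \<open>y\<close>, normalised by its value at \<open>x0\<close>, so that contact
  with \<open>u\<close> from below at \<open>x0\<close> is expressed by an inequality alone.\<close>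

definition slid_paraboloid ::
  "('a::euclidean_space \<Rightarrow> real) \<Rightarrow> real \<Rightarrow> 'a \<Rightarrow> 'a \<Rightarrow> 'a \<Rightarrow> real" where
  "slid_paraboloid u A y x0 x = u x0 + A / 2 * ((norm (x0 - y))^2 - (norm (x - y))^2)"

text \<open>The threshold is half the volume of a ball of radius \<open>r / 80\<close>, so that in every such ball inside
  the annulus at least half of the points are low. The annulus is wide enough to contain such a ball
  both at distance about \<open>r / 20\<close> from \<open>x0\<close> and, in every direction, at distance \<open>3 r / 4\<close>.\<close>

definition few_high_points ::
  "real \<Rightarrow> ('a::euclidean_space \<Rightarrow> real) \<Rightarrow> real \<Rightarrow> 'a \<Rightarrow> 'a \<Rightarrow> real \<Rightarrow> bool" where
  "few_high_points M u A y x0 r \<longleftrightarrow>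
     measure lebesgue {x. r / 40 \<le> norm (x - x0) \<and> norm (x - x0) < r \<and>
         slid_paraboloid u A y x0 x + M * A * r^2 < u x}
     \<le> vol TYPE('a) / 2 * (r / 80) ^ DIM('a)"

text \<open>The trace of the equation that the geometric part of the proof needs; \<open>F\<close> is a bound for the right
  hand side. It has no operator and no order \<open>\<sigma>\<close>, and one value of \<open>M\<close> serves for all of them.\<close>

definition has_flat_annuli :: "real \<Rightarrow> real \<Rightarrow> ('a::euclidean_space \<Rightarrow> real) \<Rightarrow> bool" where
  "has_flat_annuli M F u \<longleftrightarrow>
     (\<forall>x0 y A \<rho>. norm x0 < 1 \<longrightarrow> 0 < \<rho> \<longrightarrow> \<rho> < 1 \<longrightarrow> 0 < A \<longrightarrow> norm (x0 - y) \<le> 2 * \<rho> \<longrightarrow>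
        u x0 \<le> 2 * A * \<rho>^2 \<longrightarrow> F \<le> A * \<rho>^2 \<longrightarrow> (\<forall>x. slid_paraboloid u A y x0 x \<le> u x) \<longrightarrow>
        (\<exists>r. 0 < r \<and> r \<le> \<rho> \<and> few_high_points M u A y x0 r))"

lemma slid_low_sets:
  fixes u :: "'a::euclidean_space \<Rightarrow> real"
  assumes u: "u \<in> borel_measurable lebesgue"
  shows "{x. u x \<le> slid_paraboloid u A y x0 x + k} \<in> sets lebesgue"
proof -
  have "slid_paraboloid u A y x0 \<in> borel_measurable borel"
    unfolding slid_paraboloid_def[abs_def]
    by (intro borel_measurable_continuous_onI continuous_intros)
  then have [measurable]: "slid_paraboloid u A y x0 \<in> borel_measurable lebesgue"
    by (intro measurable_completion) simp
  have "{x\<in>space lebesgue. u x \<le> slid_paraboloid u A y x0 x + k} \<in> sets lebesgue"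
    using u by measurable
  then show ?thesis by simp
qed

lemma ball_mostly_low:
  fixes u :: "'a::euclidean_space \<Rightarrow> real"
  assumes u: "u \<in> borel_measurable lebesgue" and few: "few_high_points M u A y x0 r" and r: "0 < r"
    and c: "r / 40 + r / 80 \<le> norm (c - x0)" "norm (c - x0) + r / 80 \<le> r"
  shows "vol TYPE('a) / 2 * (r / 80) ^ DIM('a)
    \<le> measure lebesgue (ball c (r / 80) \<inter> {x. u x \<le> slid_paraboloid u A y x0 x + M * A * r^2})"
    (is "?h \<le> measure lebesgue ?G")
proof -
  let ?Q = "{x. r / 40 \<le> norm (x - x0) \<and> norm (x - x0) < r \<and>
         slid_paraboloid u A y x0 x + M * A * r^2 < u x}"
  have Q: "?Q \<in> lmeasurable"
  proof (rule bounded_set_imp_lmeasurable)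
    show "bounded ?Q"
      by (rule bounded_subset[OF bounded_ball[of x0 r]]) (auto simp: dist_norm norm_minus_commute)
    have "UNIV - {x. u x \<le> slid_paraboloid u A y x0 x + M * A * r^2} \<in> sets lebesgue"
      using slid_low_sets[OF u] by (intro sets.Diff) auto
    also have "UNIV - {x. u x \<le> slid_paraboloid u A y x0 x + M * A * r^2}
        = {x. slid_paraboloid u A y x0 x + M * A * r^2 < u x}" by auto
    finally have "{x. slid_paraboloid u A y x0 x + M * A * r^2 < u x} \<in> sets lebesgue" .
    moreover have "{x. r / 40 \<le> norm (x - x0) \<and> norm (x - x0) < r} \<in> sets lebesgue"
    proof -
      have "{x. r / 40 \<le> norm (x - x0) \<and> norm (x - x0) < r} = ball x0 r - ball x0 (r / 40)"
        by (auto simp: dist_norm norm_minus_commute)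
      then show ?thesis by simp
    qed
    ultimately have "{x. slid_paraboloid u A y x0 x + M * A * r^2 < u x}
        \<inter> {x. r / 40 \<le> norm (x - x0) \<and> norm (x - x0) < r} \<in> sets lebesgue"
      by (intro sets.Int) auto
    then show "?Q \<in> sets lebesgue" by (rule back_subst[where P="\<lambda>S. S \<in> sets lebesgue"]) auto
  qed
  have G: "?G \<in> lmeasurable"
  proof (rule bounded_set_imp_lmeasurable)
    show "bounded ?G" by (meson bounded_Int bounded_ball)
    show "?G \<in> sets lebesgue" using slid_low_sets[OF u] by (intro sets.Int) auto
  qed
  have "ball c (r / 80) \<subseteq> ?G \<union> ?Q"
  proof
    fix x assume x: "x \<in> ball c (r / 80)"
    then have "norm (x - c) < r / 80" by (simp add: dist_norm norm_minus_commute)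
    moreover have "norm (c - x0) - norm (x - c) \<le> norm (x - x0)" "norm (x - x0) \<le> norm (c - x0) + norm (x - c)"
      using norm_triangle_ineq[of "x - c" "c - x0"] norm_triangle_ineq[of "x - x0" "c - x"]
      by (auto simp: norm_minus_commute)
    ultimately show "x \<in> ?G \<union> ?Q" using c x by auto
  qed
  then have "measure lebesgue (ball c (r / 80)) \<le> measure lebesgue (?G \<union> ?Q)"
    using G Q by (intro measure_mono_fmeasurable) auto
  also have "\<dots> \<le> measure lebesgue ?G + measure lebesgue ?Q"
    using G Q by (intro measure_Un_le) auto
  also have "measure lebesgue ?Q \<le> ?h" using few unfolding few_high_points_def .
  finally show ?thesis using r by (simp add: content_ball)
qed

text \<open>The two paraboloids differ by an affine function of slope \<open>A (y1 - y0)\<close>. It is nonnegative at \<open>x1\<close>,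
  where the second one equals \<open>u\<close>, and at most \<open>M A r\<^sup>2\<close> at the low points of the annulus around \<open>x0\<close>. Some
  of those points lie at distance about \<open>r\<close> from \<open>x1\<close> in the direction of \<open>y1 - y0\<close>, which bounds the
  slope by a multiple of \<open>M A r\<close>.\<close>

lemma vertices_of_near_contacts_close:
  fixes u :: "'a::euclidean_space \<Rightarrow> real"
  assumes u: "u \<in> borel_measurable lebesgue" and few: "few_high_points M u A y0 x0 r"
    and r: "0 < r" and A: "0 < A" and M: "0 < M"
    and touch0: "\<And>x. slid_paraboloid u A y0 x0 x \<le> u x"
    and touch1: "\<And>x. slid_paraboloid u A y1 x1 x \<le> u x"
    and near: "norm (x1 - x0) \<le> r / 4"
  shows "norm (y1 - y0) \<le> 4 * M * r"
proof (cases "y1 = y0")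
  case True
  then show ?thesis using r M by simp
next
  case False
  define e where "e = sgn (y1 - y0)"
  have e: "norm e = 1" "y1 - y0 = norm (y1 - y0) *\<^sub>R e"
    using False by (simp_all add: e_def norm_sgn sgn_div_norm)
  have ee: "e \<bullet> e = 1" using e by (simp add: dot_square_norm)
  define c where "c = x0 + (3 / 4 * r) *\<^sub>R e"
  have nc: "norm (c - x0) = 3 / 4 * r" using e r by (simp add: c_def)
  have "0 < vol TYPE('a) / 2 * (r / 80) ^ DIM('a)" using r by simp
  also have "\<dots> \<le> measure lebesgue
      (ball c (r / 80) \<inter> {x. u x \<le> slid_paraboloid u A y0 x0 x + M * A * r^2})"
    by (rule ball_mostly_low[OF u few r]) (use nc r in auto)
  finally have "ball c (r / 80) \<inter> {x. u x \<le> slid_paraboloid u A y0 x0 x + M * A * r^2} \<noteq> {}"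
    by (metis less_irrefl measure_empty)
  then obtain x where x: "x \<in> ball c (r / 80)" "u x \<le> slid_paraboloid u A y0 x0 x + M * A * r^2" by auto
  have "(norm (x1 - y1))^2 - (norm (x - y1))^2 - (norm (x1 - y0))^2 + (norm (x - y0))^2
      = 2 * ((y1 - y0) \<bullet> (x - x1))"
    unfolding power2_norm_eq_inner
    by (simp add: inner_diff_left inner_diff_right inner_commute algebra_simps)
  then have "A / 2 * ((norm (x1 - y1))^2 - (norm (x - y1))^2 - (norm (x1 - y0))^2 + (norm (x - y0))^2)
      = A * ((y1 - y0) \<bullet> (x - x1))" by simp
  moreover have "A / 2 * ((norm (x1 - y1))^2 - (norm (x - y1))^2 - (norm (x1 - y0))^2 + (norm (x - y0))^2)
      \<le> M * A * r^2"
  proof -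
    have "slid_paraboloid u A y1 x1 x \<le> slid_paraboloid u A y0 x0 x + M * A * r^2"
      using touch1[of x] x(2) by linarith
    then show ?thesis using touch0[of x1] unfolding slid_paraboloid_def right_diff_distrib distrib_left
      by linarith
  qed
  ultimately have "A * ((y1 - y0) \<bullet> (x - x1)) \<le> M * A * r^2" by linarith
  then have "A * ((y1 - y0) \<bullet> (x - x1)) \<le> A * (M * r^2)" by (simp add: mult_ac)
  then have le: "(y1 - y0) \<bullet> (x - x1) \<le> M * r^2" using A by simp
  have "r / 4 \<le> e \<bullet> (x - x1)"
  proof -
    have "x - x1 = (x - c) + (3 / 4 * r) *\<^sub>R e + (x0 - x1)" by (simp add: c_def)
    then have "e \<bullet> (x - x1) = e \<bullet> ((x - c) + (3 / 4 * r) *\<^sub>R e + (x0 - x1))" by (rule arg_cong)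
    also have "\<dots> = e \<bullet> (x - c) + 3 / 4 * r + e \<bullet> (x0 - x1)"
      by (simp only: inner_add_right inner_scaleR_right ee mult_1_right)
    finally have "e \<bullet> (x - x1) = e \<bullet> (x - c) + 3 / 4 * r + e \<bullet> (x0 - x1)" .
    moreover have "\<bar>e \<bullet> (x - c)\<bar> \<le> r / 80"
      using Cauchy_Schwarz_ineq2[of e "x - c"] e x(1) by (simp add: dist_norm norm_minus_commute)
    moreover have "\<bar>e \<bullet> (x0 - x1)\<bar> \<le> r / 4"
      using Cauchy_Schwarz_ineq2[of e "x0 - x1"] e near by (simp add: norm_minus_commute)
    ultimately show ?thesis using r by linarith
  qed
  then have "norm (y1 - y0) * (r / 4) \<le> norm (y1 - y0) * (e \<bullet> (x - x1))"
    by (rule mult_left_mono) simp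
  also have "\<dots> = (y1 - y0) \<bullet> (x - x1)"
    by (simp only: inner_scaleR_left[symmetric] e(2)[symmetric])
  also note le
  finally have "r * norm (y1 - y0) \<le> r * (4 * M * r)" by (simp add: power2_eq_square mult_ac)
  then show ?thesis using r by simp
qed

text \<open>The contact point minimises \<open>u x + A / 2 |x - y|\<^sup>2\<close>. Since \<open>u \<ge> 0\<close>, the last assumption
  makes this function at distance \<open>R\<close> or more from \<open>y\<close> no smaller than it is at \<open>xs\<close>, so the minimum over the ball is global.\<close>

lemma paraboloid_touches:
  fixes u :: "'a::euclidean_space \<Rightarrow> real"
  assumes lsc: "lower_semicontinuous_on (ball 0 1) u" and pos: "\<And>x. 0 \<le> u x"
    and sub: "cball y R \<subseteq> ball 0 1" and A: "0 < A"
    and xs: "norm (xs - y) \<le> R" "u xs \<le> m" "m + A / 2 * (norm (xs - y))^2 \<le> A / 2 * R^2"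
  obtains x0 where "norm (x0 - y) \<le> R" "\<And>x. slid_paraboloid u A y x0 x \<le> u x"
    "u x0 + A / 2 * (norm (x0 - y))^2 \<le> m + A / 2 * (norm (xs - y))^2"
proof -
  define q where "q x = A / 2 * (norm (x - y))^2" for x
  have xsK: "xs \<in> cball y R" using xs(1) by (simp add: dist_norm norm_minus_commute)
  have "lower_semicontinuous_on (ball 0 1) (\<lambda>x. u x + q x)"
    unfolding q_def by (intro lsc_add_continuous lsc continuous_intros)
  then obtain x0 where x0: "x0 \<in> cball y R" "\<And>x. x \<in> cball y R \<Longrightarrow> u x0 + q x0 \<le> u x + q x"
    using lsc_attains_inf[of "cball y R" "ball 0 1" "\<lambda>x. u x + q x"] sub xsK by fastforce
  have R0: "0 \<le> R" using xs(1) norm_ge_zero order_trans by blast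
  have glob: "u x0 + q x0 \<le> u x + q x" for x
  proof (cases "x \<in> cball y R")
    case False
    then have "R^2 \<le> (norm (x - y))^2" using R0 by (intro power_mono) (auto simp: dist_norm norm_minus_commute)
    then have "A / 2 * R^2 \<le> q x" unfolding q_def using A by (intro mult_left_mono) auto
    moreover have "u x0 + q x0 \<le> m + q xs" using x0(2)[OF xsK] xs(2) by linarith
    ultimately show ?thesis using xs(3) pos[of x] unfolding q_def by linarith
  qed (rule x0(2))
  show ?thesis
  proof (rule that[of x0])
    show "norm (x0 - y) \<le> R" using x0(1) by (simp add: dist_norm norm_minus_commute)
    show "slid_paraboloid u A y x0 x \<le> u x" for x
      using glob[of x] unfolding slid_paraboloid_def q_def by (simp add: algebra_simps)
    show "u x0 + A / 2 * (norm (x0 - y))^2 \<le> m + A / 2 * (norm (xs - y))^2"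
      using glob[of xs] xs(2) unfolding q_def by linarith
  qed
qed

text \<open>Here the ball is centred at the origin, \<open>S\<close> is the given low point, \<open>Y\<close> a vertex near the midpoint
  \<open>S / 2\<close>, and \<open>X\<close> a contact point, hence almost as close to \<open>Y\<close> as \<open>S\<close> is. For \<open>Y = S / 2\<close> and without the
  error term the last assumption says that \<open>X\<close> lies in the ball with diameter from \<open>0\<close> to \<open>S\<close>, which
  touches the sphere of radius \<open>\<rho>\<close> at most at \<open>S\<close>. Moving \<open>Y\<close> by \<open>\<delta> \<rho>\<close> lets \<open>X\<close> leave the
  ball only by \<open>O(\<delta>\<^sup>2 \<rho>)\<close>, and only near \<open>S\<close>.\<close>

lemma contact_point_location:
  fixes X S Y :: "'a::euclidean_space"
  assumes \<rho>: "0 < \<rho>" and \<delta>: "0 \<le> \<delta>" "\<delta> \<le> 1" and S: "norm S \<le> \<rho>"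
    and Y: "norm (Y - S /\<^sub>R 2) \<le> \<delta> * \<rho>"
    and X: "(norm (X - Y))^2 \<le> (norm (S - Y))^2 + (\<delta> * \<rho>)^2"
  shows "norm X \<le> (1 + 3 * \<delta>^2) * \<rho>"
    and "(1 - \<delta>^2) * \<rho> \<le> norm X \<Longrightarrow> norm (X - S) \<le> 5 * (\<delta> * \<rho>)"
proof -
  define v where "v = Y - S /\<^sub>R 2"
  define t where "t = norm (X - S)"
  define k where "k = \<delta> * \<rho>"
  have k: "0 \<le> k" using \<delta> \<rho> by (simp add: k_def)
  have "(norm (S - Y))^2 - (norm (X - Y))^2
      = (norm S)^2 - (norm X)^2 + 2 * ((X - S) \<bullet> Y)"
    unfolding power2_norm_eq_inner by (simp add: inner_diff_left inner_diff_right inner_commute)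
  moreover have "2 * ((X - S) \<bullet> Y) = (X - S) \<bullet> S + 2 * ((X - S) \<bullet> v)"
    unfolding v_def by (simp add: inner_diff_right)
  moreover have "2 * ((X - S) \<bullet> S) = (norm X)^2 - (norm S)^2 - t^2"
    unfolding t_def power2_norm_eq_inner
    by (simp add: inner_diff_left inner_diff_right inner_commute)
  moreover have "(X - S) \<bullet> v \<le> t * k"
  proof -
    have "(X - S) \<bullet> v \<le> norm (X - S) * norm v" by (rule norm_cauchy_schwarz)
    also have "\<dots> \<le> t * k" using Y unfolding t_def k_def v_def by (intro mult_left_mono) auto
    finally show ?thesis .
  qed
  ultimately have main: "t^2 + (norm X)^2 - (norm S)^2 \<le> 4 * (t * k) + 2 * k^2"
    using X unfolding k_def by linarith
  have S2: "(norm S)^2 \<le> \<rho>^2" using S by (intro power_mono) auto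
  have "0 \<le> (t - 2 * k)^2" by simp
  then have "4 * (t * k) \<le> t^2 + 4 * k^2" by (simp add: power2_eq_square algebra_simps)
  then have "(norm X)^2 \<le> \<rho>^2 + 6 * k^2" using main S2 by linarith
  also have "\<dots> \<le> ((1 + 3 * \<delta>^2) * \<rho>)^2"
  proof -
    have "((1 + 3 * \<delta>^2) * \<rho>)^2 = \<rho>^2 + 6 * k^2 + (3 * \<delta>^2 * \<rho>)^2"
      unfolding k_def by (simp add: power2_eq_square algebra_simps)
    then show ?thesis by simp
  qed
  finally show "norm X \<le> (1 + 3 * \<delta>^2) * \<rho>"
    by (rule power2_le_imp_le) (use \<rho> in simp)
  assume "(1 - \<delta>^2) * \<rho> \<le> norm X"
  moreover have "0 \<le> (1 - \<delta>^2) * \<rho>" using \<delta> \<rho> by (simp add: power_le_one)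
  ultimately have "((1 - \<delta>^2) * \<rho>)^2 \<le> (norm X)^2" by (intro power_mono)
  moreover have "((1 - \<delta>^2) * \<rho>)^2 = \<rho>^2 - 2 * k^2 + (\<delta>^2 * \<rho>)^2"
    unfolding k_def by (simp add: power2_eq_square algebra_simps)
  moreover have "0 \<le> (\<delta>^2 * \<rho>)^2" by simp
  ultimately have "\<rho>^2 - 2 * k^2 \<le> (norm X)^2" by linarith
  then have "t^2 \<le> 4 * (t * k) + 4 * k^2" using main S2 by linarith
  then have "(t - 2 * k)^2 \<le> 8 * k^2" by (simp add: power2_eq_square algebra_simps)
  also have "\<dots> \<le> (3 * k)^2" by (simp add: power2_eq_square)
  finally have "t - 2 * k \<le> 3 * k" by (rule power2_le_imp_le) (use k in simp)
  then show "norm (X - S) \<le> 5 * (\<delta> * \<rho>)" unfolding t_def k_def by simp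
qed

section \<open>The low set has positive density in every ball that it meets\<close>

text \<open>The constants are chosen in the order \<open>\<gamma>\<close>, \<open>\<delta>\<close>, \<open>N\<close>: the low set has volume at least \<open>\<gamma>\<close> times that of
  the set of vertices, \<open>\<gamma>\<close> depends only on \<open>M\<close>, and \<open>\<delta>\<close> is so small that the cap outside the ball takes
  at most half of it. The opening \<open>A = N m / \<rho>\<^sup>2\<close> is large enough for \<open>m\<close> to cost only the error term
  \<open>(\<delta> \<rho>)\<^sup>2\<close> in \<open>contact_point_location\<close>.\<close>

lemma low_set_density:
  assumes M: "0 < M"
  obtains M' d :: real where "1 < M'" "0 < d" "d \<le> 1"
    "\<And>F (u :: 'a::euclidean_space \<Rightarrow> real) z \<rho> m xs.
      has_flat_annuli M F u \<Longrightarrow> lower_semicontinuous_on (ball 0 1) u \<Longrightarrow> u \<in> borel_measurable lebesgue \<Longrightarrow>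
      (\<And>x. 0 \<le> u x) \<Longrightarrow> 0 < \<rho> \<Longrightarrow> norm z + \<rho> \<le> 1 / 2 \<Longrightarrow> norm (xs - z) \<le> \<rho> \<Longrightarrow> 0 < m \<Longrightarrow>
      u xs \<le> m \<Longrightarrow> F \<le> m \<Longrightarrow>
      d * (vol TYPE('a) * \<rho> ^ DIM('a)) \<le> measure lebesgue (cball z \<rho> \<inter> {x. u x \<le> M' * m})"
proof -
  define n where "n = DIM('a)"
  define V where "V = vol TYPE('a)"
  have V: "0 < V" unfolding V_def by simp
  define \<gamma> where "\<gamma> = (1 / (320 * M)) ^ n / 2"
  have \<gamma>: "0 < \<gamma>" using M by (simp add: \<gamma>_def)
  obtain J :: nat where J: "2 * 7 ^ n / \<gamma> < real J" using reals_Archimedean2 by blast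
  have "0 \<le> 2 * 7 ^ n / \<gamma>" using \<gamma> by simp
  then have J1: "1 \<le> J" using J by linarith
  define \<delta> where "\<delta> = 1 / (41 * real J)"
  have \<delta>: "0 < \<delta>" "\<delta> \<le> 1/41" using J1 unfolding \<delta>_def by (auto simp: field_simps)
  define N where "N = 2 / \<delta>^2"
  have \<delta>2: "\<delta>^2 \<le> 1/1681" using power_mono[of \<delta> "1/41" 2] \<delta> by (simp add: power2_eq_square)
  have N: "1 \<le> N" using \<delta> \<delta>2 unfolding N_def by (simp add: field_simps)
  define M' where "M' = (4 + M) * N"
  define da where "da = (12 * \<delta>^2 / 80) ^ n / 2"
  define db where "db = \<gamma> * \<delta> ^ n / 2"
  define d where "d = min 1 (min da db)"
  show thesis
  proof (rule that[of M' d])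
    have "1 < 4 + M" using M by simp
    also have "\<dots> \<le> M'" unfolding M'_def using M N by simp
    finally show "1 < M'" .
    show "0 < d" "d \<le> 1" using \<delta> \<gamma> by (auto simp: d_def da_def db_def)
  next
    fix F m \<rho> and u :: "'a \<Rightarrow> real" and z xs :: 'a
    assume flat: "has_flat_annuli M F u" and lsc: "lower_semicontinuous_on (ball 0 1) u"
      and um: "u \<in> borel_measurable lebesgue" and pos: "\<And>x. 0 \<le> u x"
      and \<rho>: "0 < \<rho>" "norm z + \<rho> \<le> 1 / 2" and xs: "norm (xs - z) \<le> \<rho>"
      and m: "0 < m" "u xs \<le> m" "F \<le> m"
    have \<rho>1: "\<rho> \<le> 1/2" using \<rho>(2) norm_ge_zero[of z] by linarith
    define A where "A = N * m / \<rho>^2"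
    have A: "0 < A" "A * \<rho>^2 = N * m" using N m \<rho> by (simp_all add: A_def)
    have mA: "m = A / 2 * (\<delta> * \<rho>)^2"
    proof -
      have "A / 2 * (\<delta> * \<rho>)^2 = (A * \<rho>^2) * \<delta>^2 / 2" by (simp add: power_mult_distrib)
      also have "\<dots> = m" unfolding A(2) N_def using \<delta> by simp
      finally show ?thesis by simp
    qed
    have m_le: "m \<le> A * \<rho>^2" unfolding A(2) using N m by simp
    define ys where "ys = z + (xs - z) /\<^sub>R 2"
    define L where "L = cball z \<rho> \<inter> {x. u x \<le> M' * m}"
    have L: "L \<in> lmeasurable"
      using superlevel_lmeasurable(2)[OF um lmeasurable_cball]
      unfolding L_def Collect_conj_eq Collect_mem_eq .
    define \<eta> where "\<eta> = \<delta> * \<rho>"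
    have \<eta>: "0 < \<eta>" "\<eta> \<le> \<rho> / 41" using \<delta> \<rho> by (simp_all add: \<eta>_def)
    have ys: "norm (ys - z) \<le> \<rho> / 2" "norm (xs - ys) \<le> \<rho> / 2"
    proof -
      have "xs - ys = (xs - z) /\<^sub>R 2" unfolding ys_def by (simp add: algebra_simps scaleR_2 flip: scaleR_add_left)
      then show "norm (xs - ys) \<le> \<rho> / 2" using xs by simp
    qed (use xs in \<open>simp add: ys_def\<close>)
    \<comment> \<open>Each vertex yields a contact point. The bound on its distance to the vertex is the one that
      \<open>xs\<close> itself satisfies, up to \<open>\<eta>\<^sup>2\<close>; this is why \<open>A\<close> is tied to \<open>\<delta>\<close> through \<open>N\<close>.\<close>
    have "\<exists>x0 r. (norm (x0 - y))^2 \<le> (norm (xs - y))^2 + \<eta>^2 \<and> norm (x0 - y) \<le> \<rho> \<and>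
        (\<forall>x. slid_paraboloid u A y x0 x \<le> u x) \<and> u x0 \<le> 2 * A * \<rho>^2 \<and>
        0 < r \<and> r \<le> \<rho> \<and> few_high_points M u A y x0 r" if y: "y \<in> ball ys \<eta>" for y
    proof -
      define R where "R = sqrt ((norm (xs - y))^2 + \<eta>^2)"
      have yys: "norm (y - ys) \<le> \<eta>" using y by (simp add: dist_norm norm_minus_commute)
      have xsy: "norm (xs - y) \<le> \<rho> / 2 + \<eta>"
        using norm_triangle_ineq[of "xs - ys" "ys - y"] ys(2) yys by (simp add: norm_minus_commute)
      have R2: "R^2 = (norm (xs - y))^2 + \<eta>^2" unfolding R_def by simp
      have "R \<le> norm (xs - y) + \<eta>"
        by (rule power2_le_imp_le) (use \<eta> in \<open>auto simp: R2 power2_sum\<close>)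
      then have R: "R \<le> \<rho> / 2 + 2 * \<eta>" using xsy by linarith
      have R\<rho>: "R \<le> \<rho>" using R \<eta> \<rho> by linarith
      have xsR: "norm (xs - y) \<le> R" unfolding R_def by (rule real_le_rsqrt) simp
      have yz: "norm (y - z) \<le> \<rho> / 2 + \<eta>"
        using norm_triangle_ineq[of "y - ys" "ys - z"] ys(1) yys by simp
      have "cball y R \<subseteq> ball 0 1"
      proof
        fix x assume "x \<in> cball y R"
        then have "norm (x - y) \<le> R" by (simp add: dist_norm norm_minus_commute)
        moreover have "norm x \<le> norm z + norm (y - z) + norm (x - y)"
          using norm_triangle_ineq[of z "y - z"] norm_triangle_ineq[of y "x - y"] by simp
        ultimately show "x \<in> ball 0 1" using R yz \<rho> \<rho>1 \<eta> by simp
      qed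
      moreover have "m + A / 2 * (norm (xs - y))^2 \<le> A / 2 * R^2"
        unfolding R2 using mA by (simp add: \<eta>_def distrib_left)
      ultimately obtain x0 where x0: "norm (x0 - y) \<le> R" "\<And>x. slid_paraboloid u A y x0 x \<le> u x"
        "u x0 + A / 2 * (norm (x0 - y))^2 \<le> m + A / 2 * (norm (xs - y))^2"
        using paraboloid_touches[OF lsc pos _ A(1) xsR m(2)] by blast
      have "(norm (x0 - y))^2 \<le> R^2" using x0(1) by (intro power_mono) auto
      then have a: "(norm (x0 - y))^2 \<le> (norm (xs - y))^2 + \<eta>^2" unfolding R2 .
      have b: "norm (x0 - y) \<le> \<rho>" using x0(1) R\<rho> by linarith
      have ux0: "u x0 \<le> 2 * A * \<rho>^2"
      proof -
        have "(norm (xs - y))^2 \<le> \<rho>^2" using xsR R\<rho> by (intro power_mono) auto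
        then have "A / 2 * (norm (xs - y))^2 \<le> A / 2 * \<rho>^2" using A by (intro mult_left_mono) auto
        moreover have "0 \<le> A / 2 * (norm (x0 - y))^2" using A by simp
        moreover have "0 \<le> A * \<rho>^2" using A(1) by (intro mult_nonneg_nonneg) auto
        ultimately show ?thesis using x0(3) m_le by linarith
      qed
      have "norm x0 < 1"
        using x0(1) \<open>cball y R \<subseteq> ball 0 1\<close> by (auto simp: dist_norm norm_minus_commute subset_eq)
      then obtain r where "0 < r" "r \<le> \<rho>" "few_high_points M u A y x0 r"
        using flat[unfolded has_flat_annuli_def, rule_format, of x0 \<rho> A y] x0(2) ux0 b \<rho> \<rho>1 A(1) m(3) m_le
        by fastforce
      then show ?thesis using a b x0(2) ux0 by blast
    qed
    then have "\<forall>y\<in>ball ys \<eta>. \<exists>p. (norm (fst p - y))^2 \<le> (norm (xs - y))^2 + \<eta>^2 \<and>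
        norm (fst p - y) \<le> \<rho> \<and> (\<forall>x. slid_paraboloid u A y (fst p) x \<le> u x) \<and> u (fst p) \<le> 2 * A * \<rho>^2 \<and>
        0 < snd p \<and> snd p \<le> \<rho> \<and> few_high_points M u A y (fst p) (snd p)"
      by (simp only: split_paired_Ex fst_conv snd_conv) blast
    from bchoice[OF this] obtain p where p: "\<And>y. y \<in> ball ys \<eta> \<Longrightarrow>
        (norm (fst (p y) - y))^2 \<le> (norm (xs - y))^2 + \<eta>^2 \<and>
        norm (fst (p y) - y) \<le> \<rho> \<and> (\<forall>x. slid_paraboloid u A y (fst (p y)) x \<le> u x) \<and>
        u (fst (p y)) \<le> 2 * A * \<rho>^2 \<and> 0 < snd (p y) \<and> snd (p y) \<le> \<rho> \<and>
        few_high_points M u A y (fst (p y)) (snd (p y))" by blast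
    define X where "X y = fst (p y)" for y
    define r where "r y = snd (p y)" for y
    have Xr: "\<And>y. y \<in> ball ys \<eta> \<Longrightarrow> (norm (X y - y))^2 \<le> (norm (xs - y))^2 + \<eta>^2"
        "\<And>y. y \<in> ball ys \<eta> \<Longrightarrow> norm (X y - y) \<le> \<rho>"
        "\<And>y x. y \<in> ball ys \<eta> \<Longrightarrow> slid_paraboloid u A y (X y) x \<le> u x"
        "\<And>y. y \<in> ball ys \<eta> \<Longrightarrow> u (X y) \<le> 2 * A * \<rho>^2"
        "\<And>y. y \<in> ball ys \<eta> \<Longrightarrow> 0 < r y" "\<And>y. y \<in> ball ys \<eta> \<Longrightarrow> r y \<le> \<rho>"
        "\<And>y. y \<in> ball ys \<eta> \<Longrightarrow> few_high_points M u A y (X y) (r y)"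
      using p unfolding X_def r_def by blast+
    have low: "u x \<le> M' * m"
      if "y \<in> ball ys \<eta>" "u x \<le> slid_paraboloid u A y (X y) x + M * A * (r y)^2" for x y
    proof -
      have A\<rho>: "0 \<le> A * \<rho>^2" using A(1) by (intro mult_nonneg_nonneg) auto
      have "(norm (X y - y))^2 \<le> \<rho>^2" using Xr(2)[OF that(1)] by (intro power_mono) auto
      then have "(norm (X y - y))^2 - (norm (x - y))^2 \<le> \<rho>^2" by (smt (verit) zero_le_power2)
      then have "A / 2 * ((norm (X y - y))^2 - (norm (x - y))^2) \<le> A / 2 * \<rho>^2"
        using A(1) by (intro mult_left_mono) auto
      then have "slid_paraboloid u A y (X y) x \<le> 4 * (A * \<rho>^2)"
        using Xr(4)[OF that(1)] A\<rho> unfolding slid_paraboloid_def by linarith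
      moreover have "M * A * (r y)^2 \<le> M * A * \<rho>^2"
        using Xr(5,6)[OF that(1)] A(1) M by (intro mult_left_mono power_mono) auto
      ultimately have "u x \<le> (4 + M) * (A * \<rho>^2)" using that(2) by (simp add: distrib_right)
      then show ?thesis unfolding A(2) M'_def by (simp only: mult_ac)
    qed
    have loc: "norm (X y - z) \<le> (1 + 3 * \<delta>^2) * \<rho>"
      "(1 - \<delta>^2) * \<rho> \<le> norm (X y - z) \<Longrightarrow> norm (X y - xs) \<le> 5 * \<eta>" if y: "y \<in> ball ys \<eta>" for y
    proof -
      have yys: "(y - z) - (xs - z) /\<^sub>R 2 = y - ys" by (simp add: ys_def)
      have Y: "norm ((y - z) - (xs - z) /\<^sub>R 2) \<le> \<delta> * \<rho>"
        unfolding yys using y by (simp add: dist_norm norm_minus_commute \<eta>_def)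
      have X: "(norm ((X y - z) - (y - z)))^2 \<le> (norm ((xs - z) - (y - z)))^2 + (\<delta> * \<rho>)^2"
        using Xr(1)[OF y] by (simp add: \<eta>_def)
      have "0 \<le> \<delta>" "\<delta> \<le> 1" using \<delta> by auto
      note * = contact_point_location[OF \<rho>(1) this xs Y X]
      show "norm (X y - z) \<le> (1 + 3 * \<delta>^2) * \<rho>" by (rule *(1))
      show "norm (X y - xs) \<le> 5 * \<eta>" if "(1 - \<delta>^2) * \<rho> \<le> norm (X y - z)"
        using *(2)[OF that] by (simp add: \<eta>_def)
    qed
    define D where "D = \<delta>^2 * \<rho>"
    have D: "0 < D" "D \<le> \<eta>"
    proof -
      have "D = \<delta> * \<eta>" by (simp add: D_def \<eta>_def power2_eq_square)
      also have "\<dots> \<le> 1 * \<eta>" using \<eta> \<delta> by (intro mult_right_mono) auto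
      finally show "D \<le> \<eta>" by simp
    qed (use \<delta> \<rho> in \<open>simp add: D_def\<close>)
    have locD: "norm (X y - z) \<le> \<rho> + 3 * D"
      "\<rho> - D \<le> norm (X y - z) \<Longrightarrow> norm (X y - xs) \<le> 5 * \<eta>" if y: "y \<in> ball ys \<eta>" for y
      using loc[OF y] by (simp_all add: D_def algebra_simps)
    have n_eq: "DIM('a) = n" "unit_ball_vol (real n) = V" by (simp_all add: n_def V_def)
    show "d * (vol TYPE('a) * \<rho> ^ DIM('a)) \<le> measure lebesgue (cball z \<rho> \<inter> {x. u x \<le> M' * m})"
    proof (cases "\<exists>y\<in>ball ys \<eta>. 12 * \<delta>^2 * \<rho> \<le> r y")
      case True
      \<comment> \<open>An annulus of radius above \<open>12 D\<close> reaches into the ball, since its centre is outside by at most \<open>3 D\<close>.\<close>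
      then obtain y where y: "y \<in> ball ys \<eta>" "12 * D \<le> r y" by (auto simp: D_def)
      note ry = Xr(5,6)[OF y(1)]
      define t where "t = norm (X y - z)"
      obtain e where e: "norm e = 1" "z - X y = t *\<^sub>R e"
      proof (cases "X y = z")
        case True
        obtain e :: 'a where "norm e = 1" using vector_choose_size[of 1] by auto
        then show ?thesis using that[of e] True by (simp add: t_def)
      next
        case False
        then show ?thesis
          using that[of "sgn (z - X y)"] by (simp add: norm_sgn sgn_div_norm t_def norm_minus_commute)
      qed
      define c where "c = X y + (r y / 2) *\<^sub>R e"
      have cx: "norm (c - X y) = r y / 2" using e ry by (simp add: c_def)
      have "c - z = (r y / 2 - t) *\<^sub>R e" using e(2) by (simp add: c_def algebra_simps)
      then have "norm (c - z) = \<bar>r y / 2 - t\<bar>" using e by simp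
      moreover have "t \<le> \<rho> + 3 * D" "0 \<le> t" using locD(1)[OF y(1)] by (simp_all add: t_def)
      ultimately have cz: "norm (c - z) \<le> \<rho> - r y / 80" using y(2) ry D by linarith
      let ?G = "ball c (r y / 80) \<inter> {x. u x \<le> slid_paraboloid u A y (X y) x + M * A * (r y)^2}"
      have "?G \<subseteq> L"
      proof
        fix x assume x: "x \<in> ?G"
        then have "norm (x - c) \<le> r y / 80" by (simp add: dist_norm norm_minus_commute)
        then have "norm (x - z) \<le> \<rho>" using cz norm_triangle_ineq[of "x - c" "c - z"] by simp
        then show "x \<in> L" using x low[OF y(1)] unfolding L_def by (simp add: dist_norm norm_minus_commute)
      qed
      moreover have "?G \<in> sets lebesgue"
        using slid_low_sets[OF um] by (intro sets.Int) auto
      ultimately have "measure lebesgue ?G \<le> measure lebesgue L"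
        using L by (intro measure_mono_fmeasurable)
      moreover have "V / 2 * (r y / 80) ^ n \<le> measure lebesgue ?G"
        using ball_mostly_low[OF um Xr(7)[OF y(1)] ry(1), of c] cx ry unfolding n_eq by simp
      moreover have "d * (V * \<rho> ^ n) \<le> V / 2 * (r y / 80) ^ n"
      proof -
        have "d * (V * \<rho> ^ n) \<le> da * (V * \<rho> ^ n)" using V \<rho> by (intro mult_right_mono) (auto simp: d_def)
        also have "\<dots> = V / 2 * (12 * D / 80) ^ n"
          by (simp add: da_def D_def power_mult_distrib power_divide mult_ac)
        also have "\<dots> \<le> V / 2 * (r y / 80) ^ n"
          using y(2) D V by (intro mult_left_mono power_mono) auto
        finally show ?thesis .
      qed
      ultimately show ?thesis unfolding n_eq L_def by linarith
    next
      case False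
      \<comment> \<open>All radii are small, so the low sets \<open>G i\<close> stay within \<open>D\<close> of the contact points.\<close>
      then have rD: "r y < 12 * D" if "y \<in> ball ys \<eta>" for y using that by (force simp: D_def)
      have "X ` ball ys \<eta> \<subseteq> (\<Union>y\<in>ball ys \<eta>. cball (X y) (r y / 20))"
        using Xr(5) by fastforce
      moreover have "0 < r y / 20 \<and> r y / 20 \<le> 1" if "y \<in> ball ys \<eta>" for y
        using Xr(5,6)[OF that] \<rho>1 by auto
      ultimately obtain C where C: "countable C" "C \<subseteq> ball ys \<eta>"
          "pairwise (\<lambda>i j. disjnt (cball (X i) (r i / 20)) (cball (X j) (r j / 20))) C"
          "X ` ball ys \<eta> \<subseteq> (\<Union>i\<in>C. cball (X i) (5 * (r i / 20)))"
        by (rule Vitali_covering_lemma_cballs)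
      define G where "G i = cball (X i) (r i / 20) \<inter> {x. u x \<le> M' * m}" for i
      have G: "G i \<in> lmeasurable" for i
        using superlevel_lmeasurable(2)[OF um lmeasurable_cball]
        unfolding G_def Collect_conj_eq Collect_mem_eq .
      have Gbig: "V / 2 * (r i / 80) ^ n \<le> measure lebesgue (G i)" if i: "i \<in> ball ys \<eta>" for i
      proof -
        note ri = Xr(5,6)[OF i]
        obtain e :: 'a where e: "norm e = 1" using vector_choose_size[of 1] by auto
        define c where "c = X i + (3 / 80 * r i) *\<^sub>R e"
        have cx: "norm (c - X i) = 3 / 80 * r i" using e ri by (simp add: c_def)
        let ?G = "ball c (r i / 80) \<inter> {x. u x \<le> slid_paraboloid u A i (X i) x + M * A * (r i)^2}"
        have "?G \<subseteq> G i"
        proof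
          fix x assume x: "x \<in> ?G"
          then have "norm (x - c) \<le> r i / 80" by (simp add: dist_norm norm_minus_commute)
          then have "norm (x - X i) \<le> r i / 20" using cx norm_triangle_ineq[of "x - c" "c - X i"] by simp
          then show "x \<in> G i" using x low[OF i] unfolding G_def by (simp add: dist_norm norm_minus_commute)
        qed
        moreover have "?G \<in> sets lebesgue"
          using slid_low_sets[OF um] by (intro sets.Int) auto
        ultimately have "measure lebesgue ?G \<le> measure lebesgue (G i)"
          using G by (intro measure_mono_fmeasurable)
        moreover have "V / 2 * (r i / 80) ^ n \<le> measure lebesgue ?G"
          using ball_mostly_low[OF um Xr(7)[OF i] ri(1), of c] cx ri unfolding n_eq by simp
        ultimately show ?thesis by linarith
      qed
      have cover: "ball ys \<eta> \<subseteq> (\<Union>i\<in>C. cball i (4 * M * r i))"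
      proof
        fix y assume y: "y \<in> ball ys \<eta>"
        then obtain i where i: "i \<in> C" "X y \<in> cball (X i) (r i / 4)" using C(4) by fastforce
        then have iV: "i \<in> ball ys \<eta>" using C(2) by blast
        have "norm (y - i) \<le> 4 * M * r i"
          by (rule vertices_of_near_contacts_close[OF um Xr(7)[OF iV] Xr(5)[OF iV] A(1) M Xr(3)[OF iV] Xr(3)[OF y]])
            (use i in \<open>simp add: dist_norm norm_minus_commute\<close>)
        then show "y \<in> (\<Union>i\<in>C. cball i (4 * M * r i))"
          using i(1) by (auto simp: dist_norm norm_minus_commute)
      qed
      have le: "emeasure lebesgue (cball i (4 * M * r i)) \<le> ennreal (1 / \<gamma>) * emeasure lebesgue (G i)"
        if "i \<in> C" for i
      proof -
        have iV: "i \<in> ball ys \<eta>" using that C(2) by blast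
        have "4 * M * r i = (320 * M) * (r i / 80)" by simp
        then have "(4 * M * r i) ^ n = (320 * M) ^ n * (r i / 80) ^ n" by (simp only: power_mult_distrib)
        then have "V * (4 * M * r i) ^ n = 1 / \<gamma> * (V / 2 * (r i / 80) ^ n)"
          using M by (simp add: \<gamma>_def power_divide)
        also have "\<dots> \<le> 1 / \<gamma> * measure lebesgue (G i)"
          using Gbig[OF iV] \<gamma> by (intro mult_left_mono) auto
        finally have "ennreal (V * (4 * M * r i) ^ n) \<le> ennreal (1 / \<gamma> * measure lebesgue (G i))"
          by (rule ennreal_leI)
        moreover have "emeasure lebesgue (cball i (4 * M * r i)) = ennreal (V * (4 * M * r i) ^ n)"
          using emeasure_lebesgue_cball[of "4 * M * r i" i] Xr(5)[OF iV] M unfolding n_eq by simp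
        moreover have "ennreal (1 / \<gamma> * measure lebesgue (G i)) = ennreal (1 / \<gamma>) * emeasure lebesgue (G i)"
          using G[of i] \<gamma> by (simp only: ennreal_mult' emeasure_eq_measure2 zero_le_divide_1_iff less_imp_le)
        ultimately show ?thesis by simp
      qed
      have disj: "disjoint_family_on G C"
        using C(3) unfolding disjoint_family_on_def pairwise_def disjnt_def G_def by blast
      have cov_le: "emeasure lebesgue (ball ys \<eta>) \<le> ennreal (1 / \<gamma>) * emeasure lebesgue (\<Union>i\<in>C. G i)"
        by (rule emeasure_cover_le[OF C(1) _ _ disj le cover]) (use G in auto)
      obtain Z where Z: "Z \<in> lmeasurable" "real J * measure lebesgue Z \<le> V * (7 * \<delta> * \<rho>) ^ n"
        "\<And>x. \<rho> < norm (x - z) \<Longrightarrow> norm (x - z) \<le> (1 + 4 * \<delta>^2) * \<rho> \<Longrightarrow>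
          norm (x - xs) \<le> 6 * \<delta> * \<rho> \<Longrightarrow> x \<in> Z"
        using cap_outside_ball_small[OF xs \<rho>(1) J1 \<delta>_def] unfolding n_eq by metis
      have GLZ: "(\<Union>i\<in>C. G i) \<subseteq> L \<union> Z"
      proof
        fix x assume "x \<in> (\<Union>i\<in>C. G i)"
        then obtain i where i: "i \<in> C" "norm (x - X i) \<le> r i / 20" "u x \<le> M' * m"
          unfolding G_def by (auto simp: dist_norm norm_minus_commute)
        then have iV: "i \<in> ball ys \<eta>" using C(2) by blast
        have rr: "20 * norm (x - X i) \<le> 12 * D" using i(2) rD[OF iV] by linarith
        show "x \<in> L \<union> Z"
        proof (cases "norm (x - z) \<le> \<rho>")
          case True
          then show ?thesis using i(3) unfolding L_def by (simp add: dist_norm norm_minus_commute)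
        next
          case False
          have tri: "norm (x - z) \<le> norm (x - X i) + norm (X i - z)" "norm (x - xs) \<le> norm (x - X i) + norm (X i - xs)"
            using norm_triangle_ineq[of "x - X i" "X i - z"] norm_triangle_ineq[of "x - X i" "X i - xs"] by auto
          have "norm (x - z) \<le> \<rho> + 4 * D" using tri(1) locD(1)[OF iV] rr D by linarith
          moreover have "norm (X i - xs) \<le> 5 * \<eta>" by (rule locD(2)[OF iV]) (use tri(1) False rr D in linarith)
          then have "norm (x - xs) \<le> 6 * \<eta>" using tri(2) rr D by linarith
          ultimately have "x \<in> Z" using False by (intro Z(3)) (auto simp: D_def \<eta>_def algebra_simps)
          then show ?thesis by blast
        qed
      qed
      have "emeasure lebesgue (\<Union>i\<in>C. G i) \<le> emeasure lebesgue (L \<union> Z)"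
        using GLZ L Z(1) by (intro emeasure_mono) (auto intro: fmeasurableD)
      also have "\<dots> = ennreal (measure lebesgue (L \<union> Z))"
        using L Z(1) by (intro emeasure_eq_measure2) (auto intro: fmeasurable.Un)
      also have "\<dots> \<le> ennreal (measure lebesgue L + measure lebesgue Z)"
        using L Z(1) by (intro ennreal_leI measure_Un_le) auto
      finally have "ennreal (1 / \<gamma>) * emeasure lebesgue (\<Union>i\<in>C. G i)
          \<le> ennreal (1 / \<gamma>) * ennreal (measure lebesgue L + measure lebesgue Z)"
        by (rule mult_left_mono) simp
      note order_trans[OF cov_le this]
      also have "\<dots> = ennreal (1 / \<gamma> * (measure lebesgue L + measure lebesgue Z))"
        by (rule ennreal_mult[symmetric]) (use \<gamma> in auto)
      finally have "emeasure lebesgue (ball ys \<eta>) \<le> ennreal (1 / \<gamma> * (measure lebesgue L + measure lebesgue Z))" .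
      moreover have "emeasure lebesgue (ball ys \<eta>) = ennreal (V * \<eta> ^ n)"
        using emeasure_lebesgue_ball[of \<eta> ys] \<eta> unfolding n_eq by simp
      ultimately have "V * \<eta> ^ n \<le> 1 / \<gamma> * (measure lebesgue L + measure lebesgue Z)"
        using \<gamma> by (simp add: ennreal_le_iff)
      then have "\<gamma> * (V * \<eta> ^ n) \<le> measure lebesgue L + measure lebesgue Z"
        using \<gamma> by (simp add: field_simps)
      moreover have "measure lebesgue Z \<le> \<gamma> / 2 * (V * \<eta> ^ n)"
      proof -
        have "real J * measure lebesgue Z \<le> 7 ^ n * (V * \<eta> ^ n)"
          using Z(2) by (simp add: \<eta>_def power_mult_distrib mult_ac)
        also have "7 ^ n \<le> real J * (\<gamma> / 2)" using J \<gamma> by (simp add: field_simps)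
        then have "7 ^ n * (V * \<eta> ^ n) \<le> real J * (\<gamma> / 2) * (V * \<eta> ^ n)"
          using V \<eta> by (intro mult_right_mono) auto
        finally have "real J * measure lebesgue Z \<le> real J * (\<gamma> / 2 * (V * \<eta> ^ n))" by (simp add: mult_ac)
        then show ?thesis using J1 by simp
      qed
      moreover have "d * (V * \<rho> ^ n) \<le> \<gamma> / 2 * (V * \<eta> ^ n)"
      proof -
        have "d * (V * \<rho> ^ n) \<le> db * (V * \<rho> ^ n)" using V \<rho> by (intro mult_right_mono) (auto simp: d_def)
        then show ?thesis by (simp add: db_def \<eta>_def power_mult_distrib mult_ac)
      qed
      ultimately show ?thesis unfolding n_eq L_def by linarith
    qed
  qed
qed

section \<open>Decay of the superlevel sets\<close>

text \<open>Consider the balls with centre \<open>(1 - \<tau>) x\<close> and radius \<open>\<tau> / 2\<close>. They increase with \<open>\<tau>\<close>, from the point \<open>x\<close>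
  to the ball of radius \<open>1 / 2\<close>, and contain \<open>x\<close>. The least \<open>\<tau>\<close> for which the closed ball meets
  \<open>{u \<le> m}\<close> gives the ball sought. Balls centred at \<open>x\<close> would not do: they can leave
  the domain before they meet \<open>{u \<le> m}\<close>.\<close>

lemma touching_ball_in_superlevel:
  fixes u :: "'a::euclidean_space \<Rightarrow> real"
  assumes lsc: "lower_semicontinuous_on (ball 0 1) u"
    and low: "norm xs \<le> 1 / 2" "u xs \<le> m" and x: "norm x < 1 / 2" "m < u x"
  obtains z \<rho> p where "0 < \<rho>" "norm z + \<rho> \<le> 1 / 2" "norm (p - z) \<le> \<rho>" "u p \<le> m" "x \<in> ball z \<rho>"
    "ball z \<rho> \<subseteq> {y \<in> ball 0 (1 / 2). m < u y}"
proof -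
  define G where "G = cball 0 (1 / 2) \<inter> - {y \<in> ball 0 1. m < u y}"
  have G_iff: "p \<in> G \<longleftrightarrow> norm p \<le> 1 / 2 \<and> u p \<le> m" for p by (auto simp: G_def)
  have "compact G"
    unfolding G_def using lsc_superlevel_open[OF open_ball lsc, of m]
    by (intro compact_Int_closed compact_cball) (simp add: open_closed)
  define K where "K = (G \<times> {0..1::real}) \<inter> {w. norm (fst w - (1 - snd w) *\<^sub>R x) - snd w / 2 \<le> 0}"
  have K_iff: "(p, \<tau>) \<in> K \<longleftrightarrow> norm p \<le> 1 / 2 \<and> u p \<le> m \<and> 0 \<le> \<tau> \<and> \<tau> \<le> 1 \<and> norm (p - (1 - \<tau>) *\<^sub>R x) \<le> \<tau> / 2" for p \<tau>
    by (auto simp: K_def G_iff)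
  have "compact K"
    unfolding K_def using \<open>compact G\<close>
    by (intro compact_Int_closed compact_Times closed_Collect_le continuous_intros) auto
  moreover have "(xs, 1) \<in> K" unfolding K_iff using low by simp
  ultimately have "\<exists>w\<in>K. \<forall>v\<in>K. snd w \<le> snd v"
    by (intro continuous_attains_inf) (auto intro!: continuous_intros)
  then obtain p \<tau> where p: "(p, \<tau>) \<in> K" and least: "\<And>q s. (q, s) \<in> K \<Longrightarrow> \<tau> \<le> s" by fastforce
  note pK = p[unfolded K_iff]
  have "\<tau> \<noteq> 0" using pK x by auto
  then have \<tau>: "0 < \<tau>" "\<tau> \<le> 1" using pK by auto
  define z where "z = (1 - \<tau>) *\<^sub>R x"
  define \<rho> where "\<rho> = \<tau> / 2"
  have \<tau>x: "(1 - \<tau>) * norm x \<le> (1 - \<tau>) * (1 / 2)" using x \<tau> by (intro mult_left_mono) auto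
  show ?thesis
  proof (rule that[of \<rho> z p])
    show "0 < \<rho>" using \<tau> by (simp add: \<rho>_def)
    show z\<rho>: "norm z + \<rho> \<le> 1 / 2" using \<tau>x \<tau> by (simp add: z_def \<rho>_def)
    show "norm (p - z) \<le> \<rho>" "u p \<le> m" using pK by (simp_all add: z_def \<rho>_def)
    have "z - x = - \<tau> *\<^sub>R x" by (simp add: z_def algebra_simps)
    then have "norm (z - x) = \<tau> * norm x" using \<tau> by simp
    moreover have "\<tau> * norm x < \<tau> * (1 / 2)" using x \<tau> by (intro mult_strict_left_mono) auto
    ultimately show "x \<in> ball z \<rho>" by (simp add: \<rho>_def dist_norm)
    show "ball z \<rho> \<subseteq> {y \<in> ball 0 (1 / 2). m < u y}"
    proof
      fix y assume y: "y \<in> ball z \<rho>"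
      define g where "g = \<rho> - norm (y - z)"
      have g: "0 < g" "g \<le> \<rho>" using y by (auto simp: g_def dist_norm norm_minus_commute)
      have yD: "norm y < 1 / 2" using norm_triangle_ineq[of "y - z" z] g z\<rho> by (simp add: g_def)
      have "\<not> u y \<le> m"
      proof
        assume "u y \<le> m"
        have shift: "y - (1 - (\<tau> - g)) *\<^sub>R x = (y - z) + - (g *\<^sub>R x)" by (simp add: z_def algebra_simps)
        have "norm (y - (1 - (\<tau> - g)) *\<^sub>R x) \<le> norm (y - z) + g * norm x"
          unfolding shift using norm_triangle_ineq[of "y - z" "- (g *\<^sub>R x)"] g by simp
        also have "\<dots> \<le> norm (y - z) + g * (1 / 2)" using x g by (intro add_left_mono mult_left_mono) auto
        also have "\<dots> = (\<tau> - g) / 2" by (simp add: g_def \<rho>_def field_simps)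
        finally have "(y, \<tau> - g) \<in> K" unfolding K_iff using yD \<open>u y \<le> m\<close> g \<tau> by (simp add: \<rho>_def)
        then show False using least g by force
      qed
      then show "y \<in> {y \<in> ball 0 (1 / 2). m < u y}" using yD by simp
    qed
  qed
qed

text \<open>Each point of \<open>{u > m}\<close> lies in a ball \<open>B\<close> contained in this set whose closure meets \<open>{u \<le> m}\<close>. By
  \<open>low\<close>, a fraction \<open>d\<close> of \<open>B\<close> belongs to \<open>{m < u \<le> M' m}\<close>. Vitali's lemma selects disjoint balls of this kind
  that carry a fraction \<open>5\<^bsup>-n\<^esup>\<close> of \<open>{u > m}\<close>.\<close>

lemma superlevel_shrinks:
  fixes u :: "'a::euclidean_space \<Rightarrow> real"
  assumes u: "u \<in> borel_measurable lebesgue" and lsc: "lower_semicontinuous_on (ball 0 1) u"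
    and M': "1 < M'" and d: "0 < d" and m: "0 < m"
    and xs: "norm xs \<le> 1 / 2" "u xs \<le> m"
    and low: "\<And>z \<rho> p. 0 < \<rho> \<Longrightarrow> norm z + \<rho> \<le> 1 / 2 \<Longrightarrow> norm (p - z) \<le> \<rho> \<Longrightarrow> u p \<le> m \<Longrightarrow>
      d * (vol TYPE('a) * \<rho> ^ DIM('a)) \<le> measure lebesgue (cball z \<rho> \<inter> {x. u x \<le> M' * m})"
  shows "measure lebesgue {x \<in> ball 0 (1 / 2). M' * m < u x}
    \<le> (1 - d / 5 ^ DIM('a)) * measure lebesgue {x \<in> ball 0 (1 / 2). m < u x}"
proof -
  define n where "n = DIM('a)"
  define V where "V = vol TYPE('a)"
  have n_eq: "DIM('a) = n" "unit_ball_vol (real n) = V" by (simp_all add: n_def V_def)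
  have V: "0 < V" by (simp add: V_def)
  define F where "F = {x \<in> ball 0 (1 / 2). m < u x}"
  define E where "E = {x \<in> ball 0 (1 / 2). M' * m < u x}"
  have meas: "F \<in> lmeasurable" "E \<in> lmeasurable"
    unfolding F_def E_def by (rule superlevel_lmeasurable[OF u]; simp)+
  have EF: "E \<subseteq> F" using M' m by (auto simp: E_def F_def intro: less_trans[rotated])
  have "\<exists>z \<rho>. 0 < \<rho> \<and> \<rho> \<le> 1 \<and> x \<in> ball z \<rho> \<and> ball z \<rho> \<subseteq> F \<and>
      d * (V * \<rho> ^ n) \<le> measure lebesgue (ball z \<rho> \<inter> {x. u x \<le> M' * m})" if x: "x \<in> F" for x
  proof -
    have x': "norm x < 1 / 2" "m < u x" using x by (auto simp: F_def)
    obtain z \<rho> p where zp: "0 < \<rho>" "norm z + \<rho> \<le> 1 / 2" "norm (p - z) \<le> \<rho>" "u p \<le> m" "x \<in> ball z \<rho>"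
      "ball z \<rho> \<subseteq> F"
      unfolding F_def by (rule touching_ball_in_superlevel[OF lsc xs x'])
    have B: "{x \<in> ball z \<rho>. u x \<le> M' * m} \<in> lmeasurable" by (rule superlevel_lmeasurable[OF u]) simp
    have "d * (V * \<rho> ^ n) \<le> measure lebesgue (cball z \<rho> \<inter> {x. u x \<le> M' * m})"
      using low[OF zp(1-4)] unfolding n_eq .
    also have "\<dots> \<le> measure lebesgue ({x \<in> ball z \<rho>. u x \<le> M' * m} \<union> sphere z \<rho>)"
    proof (rule measure_mono_fmeasurable)
      show "cball z \<rho> \<inter> {x. u x \<le> M' * m} \<in> sets lebesgue"
        using superlevel_lmeasurable(2)[OF u lmeasurable_cball, of z \<rho> "M' * m"]
        unfolding Collect_conj_eq Collect_mem_eq by (rule fmeasurableD)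
      show "{x \<in> ball z \<rho>. u x \<le> M' * m} \<union> sphere z \<rho> \<in> lmeasurable"
        using B negligible_sphere[of z \<rho>] by (intro fmeasurable.Un) (auto intro: negligible_imp_measurable)
    qed auto
    also have "\<dots> \<le> measure lebesgue {x \<in> ball z \<rho>. u x \<le> M' * m} + measure lebesgue (sphere z \<rho>)"
      using B negligible_sphere[of z \<rho>] by (intro measure_Un_le) (auto simp: negligible_iff_null_sets)
    also have "measure lebesgue (sphere z \<rho>) = 0" by (rule negligible_imp_measure0[OF negligible_sphere])
    finally have "d * (V * \<rho> ^ n) \<le> measure lebesgue (ball z \<rho> \<inter> {x. u x \<le> M' * m})"
      by (simp only: Collect_conj_eq Collect_mem_eq)
    moreover have "\<rho> \<le> 1" using zp(2) norm_ge_zero[of z] by linarith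
    ultimately show ?thesis using zp by blast
  qed
  then have "\<forall>x\<in>F. \<exists>w. 0 < snd w \<and> snd w \<le> 1 \<and> x \<in> ball (fst w) (snd w) \<and> ball (fst w) (snd w) \<subseteq> F \<and>
      d * (V * snd w ^ n) \<le> measure lebesgue (ball (fst w) (snd w) \<inter> {x. u x \<le> M' * m})"
    by (simp only: split_paired_Ex fst_conv snd_conv) blast
  from bchoice[OF this] obtain w where w: "\<And>x. x \<in> F \<Longrightarrow> 0 < snd (w x) \<and> snd (w x) \<le> 1 \<and>
      x \<in> ball (fst (w x)) (snd (w x)) \<and> ball (fst (w x)) (snd (w x)) \<subseteq> F \<and>
      d * (V * snd (w x) ^ n) \<le> measure lebesgue (ball (fst (w x)) (snd (w x)) \<inter> {x. u x \<le> M' * m})"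
    by blast
  define Z where "Z x = fst (w x)" for x
  define r where "r x = snd (w x)" for x
  have Zr: "\<And>x. x \<in> F \<Longrightarrow> 0 < r x \<and> r x \<le> 1" "\<And>x. x \<in> F \<Longrightarrow> x \<in> ball (Z x) (r x)"
    "\<And>x. x \<in> F \<Longrightarrow> ball (Z x) (r x) \<subseteq> F"
    "\<And>x. x \<in> F \<Longrightarrow> d * (V * r x ^ n) \<le> measure lebesgue (ball (Z x) (r x) \<inter> {x. u x \<le> M' * m})"
    using w unfolding Z_def r_def by blast+
  have "F \<subseteq> (\<Union>x\<in>F. ball (Z x) (r x))" using Zr(2) by blast
  then obtain C where C: "countable C" "C \<subseteq> F"
      "pairwise (\<lambda>i j. disjnt (ball (Z i) (r i)) (ball (Z j) (r j))) C"
      "F \<subseteq> (\<Union>i\<in>C. ball (Z i) (5 * r i))"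
    using Vitali_covering_lemma_balls[where S=F and K=F and a=Z and r=r and B=1] Zr(1) by blast
  define G where "G i = {x \<in> ball (Z i) (r i). u x \<le> M' * m}" for i
  have G: "G i \<in> lmeasurable" for i
    unfolding G_def by (rule superlevel_lmeasurable[OF u]) simp
  have le: "emeasure lebesgue (ball (Z i) (5 * r i)) \<le> ennreal (5 ^ n / d) * emeasure lebesgue (G i)"
    if "i \<in> C" for i
  proof -
    have iF: "i \<in> F" using that C(2) by blast
    have "d * (V * r i ^ n) \<le> measure lebesgue (G i)"
      using Zr(4)[OF iF] unfolding G_def by (simp only: Collect_conj_eq Collect_mem_eq)
    then have "5 ^ n / d * (d * (V * r i ^ n)) \<le> 5 ^ n / d * measure lebesgue (G i)"
      using d by (intro mult_left_mono) auto
    then have "V * (5 * r i) ^ n \<le> 5 ^ n / d * measure lebesgue (G i)"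
      using d by (simp add: power_mult_distrib mult_ac)
    then have "ennreal (V * (5 * r i) ^ n) \<le> ennreal (5 ^ n / d * measure lebesgue (G i))"
      by (rule ennreal_leI)
    also have "\<dots> = ennreal (5 ^ n / d) * ennreal (measure lebesgue (G i))"
      by (rule ennreal_mult) (use d in auto)
    also have "ennreal (measure lebesgue (G i)) = emeasure lebesgue (G i)"
      using G by (rule emeasure_eq_measure2[symmetric])
    finally show ?thesis
      using emeasure_lebesgue_ball[of "5 * r i" "Z i"] Zr(1)[OF iF] unfolding n_eq by simp
  qed
  have disj: "disjoint_family_on G C"
    using C(3) unfolding disjoint_family_on_def pairwise_def disjnt_def G_def by blast
  have "emeasure lebesgue F \<le> ennreal (5 ^ n / d) * emeasure lebesgue (\<Union>i\<in>C. G i)"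
    by (rule emeasure_cover_le[OF C(1) _ _ disj le C(4)]) (use G in auto)
  also have "\<dots> \<le> ennreal (5 ^ n / d) * emeasure lebesgue (F - E)"
  proof (intro mult_left_mono emeasure_mono)
    show "(\<Union>i\<in>C. G i) \<subseteq> F - E"
    proof
      fix x assume "x \<in> (\<Union>i\<in>C. G i)"
      then obtain i where i: "i \<in> C" "x \<in> ball (Z i) (r i)" "u x \<le> M' * m" by (auto simp: G_def)
      then have "x \<in> F" using Zr(3)[of i] C(2) by blast
      then show "x \<in> F - E" using i(3) by (simp add: E_def)
    qed
    show "F - E \<in> sets lebesgue" using meas by (auto intro: fmeasurableD)
  qed simp
  also have "emeasure lebesgue (F - E) = ennreal (measure lebesgue (F - E))"
    using meas by (intro emeasure_eq_measure2) (auto intro: fmeasurable.Diff)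
  also have "ennreal (5 ^ n / d) * \<dots> = ennreal (5 ^ n / d * measure lebesgue (F - E))"
    by (rule ennreal_mult[symmetric]) (use d in auto)
  also have "emeasure lebesgue F = ennreal (measure lebesgue F)"
    using meas(1) by (rule emeasure_eq_measure2)
  finally have "measure lebesgue F \<le> 5 ^ n / d * measure lebesgue (F - E)"
    using d by (simp add: ennreal_le_iff)
  moreover have "measure lebesgue (F - E) = measure lebesgue F - measure lebesgue E"
    using meas EF by (intro measurable_measure_Diff) (auto intro: fmeasurableD)
  ultimately have "d / 5 ^ n * measure lebesgue F \<le> measure lebesgue F - measure lebesgue E"
    using d by (simp add: field_simps)
  then show ?thesis unfolding n_eq F_def E_def by (simp add: algebra_simps)
qed

lemma superlevel_geometric_decay:
  fixes u :: "'a::euclidean_space \<Rightarrow> real"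
  assumes u: "u \<in> borel_measurable lebesgue" and lsc: "lower_semicontinuous_on (ball 0 1) u"
    and M': "1 < M'" and d: "0 < d" "d \<le> 1" and m: "0 < m"
    and xs: "norm xs \<le> 1 / 2" "u xs \<le> m"
    and low: "\<And>z \<rho> p t. 0 < \<rho> \<Longrightarrow> norm z + \<rho> \<le> 1 / 2 \<Longrightarrow> norm (p - z) \<le> \<rho> \<Longrightarrow> m \<le> t \<Longrightarrow> u p \<le> t \<Longrightarrow>
      d * (vol TYPE('a) * \<rho> ^ DIM('a)) \<le> measure lebesgue (cball z \<rho> \<inter> {x. u x \<le> M' * t})"
  shows "measure lebesgue {x \<in> ball 0 (1 / 2). m * M' ^ k < u x}
    \<le> (1 - d / 5 ^ DIM('a)) ^ k * measure lebesgue (ball (0::'a) (1 / 2))"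
proof (induction k)
  case 0
  have "{x \<in> ball 0 (1 / 2). m < u x} \<subseteq> ball 0 (1 / 2)" by auto
  then have "measure lebesgue {x \<in> ball 0 (1 / 2). m < u x} \<le> measure lebesgue (ball (0::'a) (1 / 2))"
    using superlevel_lmeasurable(1)[OF u, of "ball 0 (1/2)" m]
    by (intro measure_mono_fmeasurable) (auto intro: fmeasurableD)
  then show ?case by simp
next
  case (Suc k)
  have ge: "m \<le> m * M' ^ k" using m M' by (simp add: one_le_power)
  have c: "0 \<le> 1 - d / 5 ^ DIM('a)"
  proof -
    have "d / 5 ^ DIM('a) \<le> 1 / 5 ^ DIM('a)" using d by (intro divide_right_mono) auto
    also have "\<dots> \<le> 1" by (simp add: one_le_power)
    finally show ?thesis by simp
  qed
  have "measure lebesgue {x \<in> ball 0 (1 / 2). M' * (m * M' ^ k) < u x}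
    \<le> (1 - d / 5 ^ DIM('a)) * measure lebesgue {x \<in> ball 0 (1 / 2). m * M' ^ k < u x}"
  proof (rule superlevel_shrinks[OF u lsc M' d(1) _ xs(1)])
    show "0 < m * M' ^ k" "u xs \<le> m * M' ^ k" using ge m xs(2) by linarith+
    show "d * (vol TYPE('a) * \<rho> ^ DIM('a)) \<le> measure lebesgue (cball z \<rho> \<inter> {x. u x \<le> M' * (m * M' ^ k)})"
      if "0 < \<rho>" "norm z + \<rho> \<le> 1 / 2" "norm (p - z) \<le> \<rho>" "u p \<le> m * M' ^ k" for z \<rho> p
      by (rule low[OF that(1-3) ge that(4)])
  qed
  also have "\<dots> \<le> (1 - d / 5 ^ DIM('a)) * ((1 - d / 5 ^ DIM('a)) ^ k * measure lebesgue (ball (0::'a) (1 / 2)))"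
    using Suc.IH c by (rule mult_left_mono)
  finally show ?case by (simp add: mult_ac)
qed

text \<open>The exponent is the one with \<open>b\<^bsup>-\<epsilon>\<^esup> = q\<close>. The factor \<open>b\<^bsup>\<epsilon>\<^esup>\<close> pays for the
  rounding of \<open>t / m\<close> to a power of \<open>b\<close>.\<close>

lemma geometric_decay_imp_power_decay:
  fixes \<mu> :: "real \<Rightarrow> real"
  assumes q: "0 < q" "q < 1" and b: "1 < b" and m: "0 < m" and W: "0 \<le> W"
    and anti: "\<And>s t. s \<le> t \<Longrightarrow> \<mu> t \<le> \<mu> s" and top: "\<And>t. \<mu> t \<le> W"
    and decay: "\<And>k. \<mu> (m * b ^ k) \<le> q ^ k * W" and t: "0 < t"
    and \<epsilon>: "\<epsilon> = - ln q / ln b"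
  shows "\<mu> t \<le> b powr \<epsilon> * W * (m powr \<epsilon> * t powr (- \<epsilon>))"
proof -
  have \<epsilon>0: "0 < \<epsilon>" unfolding \<epsilon> using q b by (intro divide_pos_pos) auto
  have bq: "b powr (- \<epsilon>) = q" unfolding \<epsilon> powr_def using q b by simp
  have mt: "m powr \<epsilon> * t powr (- \<epsilon>) = (t / m) powr (- \<epsilon>)"
    using m t by (simp add: powr_divide powr_minus field_simps)
  show ?thesis
  proof (cases "t < m")
    case True
    have "1 \<le> (m / t) powr \<epsilon>" using True t \<epsilon>0 by (intro ge_one_powr_ge_zero) auto
    then have "1 \<le> m powr \<epsilon> * t powr (- \<epsilon>)" using m t by (simp add: powr_divide powr_minus field_simps)
    moreover have "1 \<le> b powr \<epsilon>" using b \<epsilon>0 by (intro ge_one_powr_ge_zero) auto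
    ultimately have "1 * W * 1 \<le> b powr \<epsilon> * W * (m powr \<epsilon> * t powr (- \<epsilon>))"
      using W by (intro mult_mono) auto
    then show ?thesis using top[of t] by linarith
  next
    case False
    then obtain k where k: "m * b ^ k \<le> t" "t < m * b ^ Suc k"
      using geometric_scale[of m t b] m b by auto
    have "\<mu> t \<le> q ^ k * W" using anti[OF k(1)] decay[of k] by linarith
    also have "q ^ k = b powr \<epsilon> * (b ^ Suc k) powr (- \<epsilon>)"
    proof -
      have "(b ^ Suc k) powr (- \<epsilon>) = q ^ Suc k"
        unfolding bq[symmetric] using b by (simp add: powr_power powr_realpow[symmetric] powr_powr del: power_Suc) (simp add: mult_ac)
      moreover have "b powr \<epsilon> * q = 1" unfolding bq[symmetric] using b by (simp add: powr_minus)
      ultimately show ?thesis by simp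
    qed
    also have "\<dots> * W \<le> b powr \<epsilon> * (t / m) powr (- \<epsilon>) * W"
    proof (intro mult_right_mono mult_left_mono)
      show "(b ^ Suc k) powr (- \<epsilon>) \<le> (t / m) powr (- \<epsilon>)"
        using k(2) t m \<epsilon>0 by (intro powr_mono2') (auto simp: field_simps)
    qed (use W in auto)
    finally show ?thesis unfolding mt by (simp add: mult_ac)
  qed
qed

section \<open>The operators on a truncated test function\<close>

lemma integral_le_of_nn_integral_le:
  fixes f :: "'a::euclidean_space \<Rightarrow> real"
  assumes f: "f \<in> borel_measurable lebesgue" and g: "g \<in> borel_measurable borel"
    and nonneg: "AE x in lebesgue. 0 \<le> f x" and le: "AE x in lebesgue. f x \<le> c * g x"
    and c: "0 \<le> c" and S: "0 \<le> S" "(\<integral>\<^sup>+x. ennreal (g x) \<partial>lebesgue) \<le> ennreal S"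
  shows "integrable lebesgue f" "integral\<^sup>L lebesgue f \<le> c * S"
proof -
  have gm: "g \<in> borel_measurable lebesgue" using g by (intro measurable_completion) simp
  have "(\<integral>\<^sup>+x. ennreal (f x) \<partial>lebesgue) \<le> (\<integral>\<^sup>+x. ennreal c * ennreal (g x) \<partial>lebesgue)"
    using le c by (intro nn_integral_mono_AE) (auto simp: ennreal_mult'[symmetric] elim!: eventually_mono intro: ennreal_leI)
  also have "\<dots> = ennreal c * (\<integral>\<^sup>+x. ennreal (g x) \<partial>lebesgue)"
    using gm by (intro nn_integral_cmult) auto
  also have "\<dots> \<le> ennreal c * ennreal S" using S by (intro mult_left_mono) auto
  also have "\<dots> = ennreal (c * S)" using c S by (simp add: ennreal_mult)
  finally have bound: "(\<integral>\<^sup>+x. ennreal (f x) \<partial>lebesgue) \<le> ennreal (c * S)" .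
  show "integrable lebesgue f"
    by (rule integrableI_nonneg[OF f nonneg]) (use bound in \<open>auto intro: le_less_trans\<close>)
  have "integral\<^sup>L lebesgue f = enn2real (\<integral>\<^sup>+x. ennreal (f x) \<partial>lebesgue)"
    by (rule integral_eq_nn_integral[OF f nonneg])
  also have "\<dots> \<le> enn2real (ennreal (c * S))" using bound by (intro enn2real_mono) auto
  finally show "integral\<^sup>L lebesgue f \<le> c * S" using c S by simp
qed

lemma norm_powr_borel: "(\<lambda>y :: 'a::euclidean_space. norm y powr e) \<in> borel_measurable borel"
  by measurable

lemma AE_lebesgue_nonzero: "AE y in lebesgue. (y :: 'a::euclidean_space) \<noteq> 0"
  by (rule AE_completion[OF AE_lborel_singleton])

abbreviation kernel_const :: "'n::finite itself \<Rightarrow> real" where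
  "kernel_const _ \<equiv> 2 ^ (CARD('n) + 1) * vol TYPE(real^'n)"

text \<open>The bounds are required off the origin only, as in \<^const>\<open>kernel_family\<close>; the value of \<open>K\<close> at \<open>0\<close> is arbitrary
  and may be negative.\<close>

locale elliptic_kernel =
  fixes \<sigma> lam Lam :: real and K :: "real^'n \<Rightarrow> real"
  assumes \<sigma>: "1 \<le> \<sigma>" "\<sigma> < 2" and lam: "0 < lam" "lam \<le> Lam"
    and meas: "K \<in> borel_measurable lebesgue"
    and lower: "\<And>y. y \<noteq> 0 \<Longrightarrow> K_minus \<sigma> lam y \<le> K y"
    and upper: "\<And>y. y \<noteq> 0 \<Longrightarrow> K y \<le> K_plus \<sigma> Lam y"
begin

lemma nonneg: "y \<noteq> 0 \<Longrightarrow> 0 \<le> K y"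
proof -
  assume "y \<noteq> 0"
  have "0 \<le> K_minus \<sigma> lam y" unfolding K_minus_def using lam \<sigma> by (intro mult_nonneg_nonneg) auto
  also note lower[OF \<open>y \<noteq> 0\<close>]
  finally show ?thesis .
qed

lemma second_moment_inside:
  assumes \<rho>: "0 < \<rho>"
  shows "integrable lebesgue (\<lambda>y. (norm y)^2 * K y * indicator (ball 0 \<rho>) y)" (is "integrable _ ?f")
    and "(\<integral>y. (norm y)^2 * K y * indicator (ball 0 \<rho>) y \<partial>lebesgue)
        \<le> Lam * kernel_const TYPE('n) * \<rho> powr (2 - \<sigma>)"
proof -
  define g where "g y = norm y powr (2 - (real CARD('n) + \<sigma>)) * indicator (ball 0 \<rho>) y" for y :: "real^'n"
  have S: "(\<integral>\<^sup>+y. ennreal (g y) \<partial>lebesgue)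
      \<le> ennreal (kernel_const TYPE('n) / (2 - \<sigma>) * \<rho> powr (2 - \<sigma>))"
    using nn_integral_norm_powr_inside[OF \<sigma> \<rho>, where 'a="real^'n"] unfolding g_def by simp
  have le: "?f y \<le> Lam * (2 - \<sigma>) * g y" if "y \<noteq> 0" for y
  proof -
    have "(norm y)^2 * K y \<le> (norm y)^2 * K_plus \<sigma> Lam y"
      using upper[OF that] by (intro mult_left_mono) auto
    also have "\<dots> = Lam * (2 - \<sigma>) * norm y powr (2 - (real CARD('n) + \<sigma>))"
    proof -
      have "(norm y)^2 * norm y powr (- (real CARD('n) + \<sigma>)) = norm y powr 2 * norm y powr (- (real CARD('n) + \<sigma>))"
        using that by simp
      also have "\<dots> = norm y powr (2 - (real CARD('n) + \<sigma>))" by (simp only: powr_add[symmetric]) (simp add: algebra_simps)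
      finally have "(norm y)^2 * norm y powr (- (real CARD('n) + \<sigma>)) = norm y powr (2 - (real CARD('n) + \<sigma>))" .
      then show ?thesis unfolding K_plus_def by (simp only: mult_ac)
    qed
    finally show ?thesis unfolding g_def by (auto split: split_indicator)
  qed
  have gm: "g \<in> borel_measurable borel" unfolding g_def
    by (intro borel_measurable_times norm_powr_borel borel_measurable_indicator) auto
  have fm: "?f \<in> borel_measurable lebesgue"
    using meas by (intro borel_measurable_times borel_measurable_indicator) (auto intro!: measurable_completion)
  have f0: "AE y in lebesgue. 0 \<le> ?f y"
    using AE_lebesgue_nonzero by eventually_elim (auto intro!: mult_nonneg_nonneg nonneg)
  have fle: "AE y in lebesgue. ?f y \<le> Lam * (2 - \<sigma>) * g y"
    using AE_lebesgue_nonzero by eventually_elim (rule le)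
  have c: "0 \<le> Lam * (2 - \<sigma>)" "0 \<le> kernel_const TYPE('n) / (2 - \<sigma>) * \<rho> powr (2 - \<sigma>)"
    using lam \<sigma> by auto
  show "integrable lebesgue ?f"
    by (rule integral_le_of_nn_integral_le(1)[OF fm gm f0 fle c S])
  have "integral\<^sup>L lebesgue ?f \<le> Lam * (2 - \<sigma>) * (kernel_const TYPE('n) / (2 - \<sigma>) * \<rho> powr (2 - \<sigma>))"
    by (rule integral_le_of_nn_integral_le(2)[OF fm gm f0 fle c S])
  also have "\<dots> = Lam * kernel_const TYPE('n) * \<rho> powr (2 - \<sigma>)" using \<sigma> by simp
  finally show "integral\<^sup>L lebesgue ?f \<le> Lam * kernel_const TYPE('n) * \<rho> powr (2 - \<sigma>)" .
qed

lemma mass_outside: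
  assumes \<rho>: "0 < \<rho>"
  shows "integrable lebesgue (\<lambda>y. K y * indicator (- ball 0 \<rho>) y)" (is "integrable _ ?f")
    and "(\<integral>y. K y * indicator (- ball 0 \<rho>) y \<partial>lebesgue)
        \<le> Lam * kernel_const TYPE('n) * \<rho> powr (- \<sigma>)"
proof -
  define g where "g y = norm y powr (- (real CARD('n) + \<sigma>)) * indicator (- ball 0 \<rho>) y" for y :: "real^'n"
  have S: "(\<integral>\<^sup>+y. ennreal (g y) \<partial>lebesgue) \<le> ennreal (kernel_const TYPE('n) * \<rho> powr (- \<sigma>))"
    using nn_integral_norm_powr_outside[OF \<sigma>(1) \<rho>, where 'a="real^'n"] unfolding g_def by simp
  have le: "?f y \<le> Lam * g y" if "y \<noteq> 0" for y
  proof -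
    have "K y \<le> K_plus \<sigma> Lam y" by (rule upper[OF that])
    also have "\<dots> \<le> Lam * norm y powr (- (real CARD('n) + \<sigma>))"
      unfolding K_plus_def using \<sigma> lam by (intro mult_right_mono mult_left_le) auto
    finally show ?thesis unfolding g_def by (auto split: split_indicator)
  qed
  have gm: "g \<in> borel_measurable borel" unfolding g_def
    by (intro borel_measurable_times norm_powr_borel borel_measurable_indicator) auto
  have fm: "?f \<in> borel_measurable lebesgue"
    using meas by (intro borel_measurable_times borel_measurable_indicator) auto
  have f0: "AE y in lebesgue. 0 \<le> ?f y"
    using AE_lebesgue_nonzero by eventually_elim (auto intro!: mult_nonneg_nonneg nonneg)
  have fle: "AE y in lebesgue. ?f y \<le> Lam * g y"
    using AE_lebesgue_nonzero by eventually_elim (rule le)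
  have c: "0 \<le> Lam" "0 \<le> kernel_const TYPE('n) * \<rho> powr (- \<sigma>)" using lam by auto
  show "integrable lebesgue ?f"
    by (rule integral_le_of_nn_integral_le(1)[OF fm gm f0 fle c S])
  have "integral\<^sup>L lebesgue ?f \<le> Lam * (kernel_const TYPE('n) * \<rho> powr (- \<sigma>))"
    by (rule integral_le_of_nn_integral_le(2)[OF fm gm f0 fle c S])
  then show "integral\<^sup>L lebesgue ?f \<le> Lam * kernel_const TYPE('n) * \<rho> powr (- \<sigma>)" by (simp add: mult_ac)
qed

lemma first_moment_annulus:
  assumes \<rho>: "0 < \<rho>"
  shows "set_integrable lebesgue (ball 0 1 - ball 0 \<rho>) (\<lambda>y. K y *\<^sub>R y)"
    and "norm (LINT y:(ball 0 1 - ball 0 \<rho>)|lebesgue. K y *\<^sub>R y)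
          \<le> Lam * kernel_const TYPE('n) * \<rho> powr (- \<sigma>)"
proof -
  let ?f = "\<lambda>y. indicator (ball 0 1 - ball 0 \<rho>) y *\<^sub>R (K y *\<^sub>R y)"
  have le: "norm (?f y) \<le> K y * indicator (- ball 0 \<rho>) y" for y
  proof (cases "y = 0")
    case False
    have "K y * norm y \<le> K y * 1" if "norm y < 1"
      using nonneg[OF False] that by (intro mult_left_mono) auto
    then show ?thesis using nonneg[OF False] by (auto simp: indicator_def)
  qed (use \<rho> in \<open>auto simp: indicator_def\<close>)
  have fm: "?f \<in> borel_measurable lebesgue"
    using meas by (intro borel_measurable_scaleR borel_measurable_indicator) (auto intro!: measurable_completion)
  have "integrable lebesgue ?f"
    by (rule Bochner_Integration.integrable_bound[OF mass_outside(1)[OF \<rho>] fm]) (use le in \<open>auto intro: order_trans[OF _ abs_ge_self]\<close>)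
  then show "set_integrable lebesgue (ball 0 1 - ball 0 \<rho>) (\<lambda>y. K y *\<^sub>R y)"
    unfolding set_integrable_def .
  have "norm (integral\<^sup>L lebesgue ?f) \<le> (\<integral>y. K y * indicator (- ball 0 \<rho>) y \<partial>lebesgue)"
    by (rule Bochner_Integration.integral_norm_bound_integral[OF \<open>integrable lebesgue ?f\<close> mass_outside(1)[OF \<rho>]]) (rule le)
  with mass_outside(2)[OF \<rho>] show "norm (LINT y:(ball 0 1 - ball 0 \<rho>)|lebesgue. K y *\<^sub>R y)
          \<le> Lam * kernel_const TYPE('n) * \<rho> powr (- \<sigma>)"
    unfolding set_lebesgue_integral_def by linarith
qed

text \<open>The drift felt at scale \<open>\<rho>\<close> is \<open>b\<close> minus the first moment of \<open>K\<close> over the annulus, while the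
  hypothesis concerns \<open>b\<close> plus this moment. The two differ by \<open>2 b\<close> up to sign, and \<open>b\<close> itself is bounded by the
  hypothesis at radius \<open>1 / 2\<close>, where the first moment is bounded by the mass of \<open>K\<close>. Since
  \<open>\<sigma> \<ge> 1\<close>, constants are at most multiples of \<open>\<rho>\<^bsup>1-\<sigma>\<^esup>\<close>.\<close>

lemma effective_drift_bound:
  assumes b: "drift_bound \<sigma> \<beta> K b" and \<rho>: "0 < \<rho>" "\<rho> < 1" and \<beta>: "0 < \<beta>"
  shows "norm (b - (LINT y:(ball 0 1 - ball 0 \<rho>)|lebesgue. K y *\<^sub>R y))
    \<le> (5 * \<beta> + 8 * Lam * kernel_const TYPE('n)) * \<rho> powr (1 - \<sigma>)"
proof -
  define I where "I r = (LINT y:(ball 0 1 - ball 0 r)|lebesgue. K y *\<^sub>R y)" for r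
  define C0 where "C0 = Lam * kernel_const TYPE('n)"
  have C0: "0 \<le> C0" using lam by (simp add: C0_def)
  have bd: "norm (b + I r) \<le> \<beta> * r powr (1 - \<sigma>)" if "0 < r" "r < 1" for r
  proof -
    have "r powr (\<sigma> - 1) * norm (b + I r) \<le> \<beta>"
      using b that unfolding drift_bound_def I_def by auto
    then have "r powr (1 - \<sigma>) * (r powr (\<sigma> - 1) * norm (b + I r)) \<le> r powr (1 - \<sigma>) * \<beta>"
      by (intro mult_left_mono) auto
    moreover have "r powr (1 - \<sigma>) * (r powr (\<sigma> - 1) * norm (b + I r)) = norm (b + I r)"
    proof -
      have "r powr (1 - \<sigma>) * r powr (\<sigma> - 1) = 1" using that by (simp only: powr_add[symmetric]) simp
      then show ?thesis by (simp only: mult.assoc[symmetric] mult_1_left)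
    qed
    ultimately have "norm (b + I r) \<le> r powr (1 - \<sigma>) * \<beta>" by linarith
    then show ?thesis by (simp only: mult.commute)
  qed
  have half: "(1/2::real) powr (1 - \<sigma>) \<le> 2" "(1/2::real) powr (- \<sigma>) \<le> 4"
  proof -
    have "(1/2::real) powr (1 - \<sigma>) \<le> (1/2) powr (-1)" by (rule powr_mono') (use \<sigma> in auto)
    then show "(1/2::real) powr (1 - \<sigma>) \<le> 2" by (simp add: powr_minus)
    have "(1/2::real) powr (- \<sigma>) \<le> (1/2) powr (-2)" by (rule powr_mono') (use \<sigma> in auto)
    then show "(1/2::real) powr (- \<sigma>) \<le> 4" by (simp add: powr_minus power2_eq_square)
  qed
  have "norm (I (1/2)) \<le> C0 * (1/2) powr (- \<sigma>)"
    using first_moment_annulus(2)[of "1/2"] unfolding I_def C0_def by simp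
  also have "\<dots> \<le> C0 * 4" using half C0 by (intro mult_left_mono) auto
  finally have I2: "norm (I (1/2)) \<le> 4 * C0" by simp
  have "norm (b + I (1/2)) \<le> \<beta> * (1/2) powr (1 - \<sigma>)" by (rule bd) auto
  also have "\<dots> \<le> \<beta> * 2" using half \<beta> by (intro mult_left_mono) auto
  finally have "norm b \<le> 2 * \<beta> + 4 * C0"
    using I2 norm_triangle_ineq4[of "b + I (1/2)" "I (1/2)"] by simp
  then have b2: "2 * norm b \<le> (4 * \<beta> + 8 * C0) * 1" by simp
  have "1 \<le> \<rho> powr (1 - \<sigma>)" using powr_mono'[of "1 - \<sigma>" 0 \<rho>] \<rho> \<sigma> by simp
  then have "(4 * \<beta> + 8 * C0) * 1 \<le> (4 * \<beta> + 8 * C0) * \<rho> powr (1 - \<sigma>)"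
    using \<beta> C0 by (intro mult_left_mono) auto
  moreover have "norm (b - I \<rho>) \<le> 2 * norm b + norm (b + I \<rho>)"
  proof -
    have eq: "b - I \<rho> = 2 *\<^sub>R b - (b + I \<rho>)" by (simp add: scaleR_2)
    show ?thesis unfolding eq using norm_triangle_ineq4[of "2 *\<^sub>R b" "b + I \<rho>"] by simp
  qed
  ultimately have "norm (b - I \<rho>) \<le> (4 * \<beta> + 8 * C0) * \<rho> powr (1 - \<sigma>) + \<beta> * \<rho> powr (1 - \<sigma>)"
    using b2 bd[OF \<rho>] by linarith
  then show ?thesis unfolding I_def[symmetric] C0_def by (simp add: algebra_simps)
qed

text \<open>For a function that vanishes at distance at least \<open>\<rho>\<close> from \<open>x0\<close>, the compensator is kept inside the
  ball of radius \<open>\<rho>\<close>, where it cancels the gradient of the paraboloid, and is moved to the drift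
  outside. Boundedness of \<open>w\<close> and its vanishing near \<open>0\<close> make each term integrable.\<close>

lemma nonlocal_op_truncated:
  fixes \<phi> w :: "real^'n \<Rightarrow> real" and p x0 :: "real^'n"
  assumes s: "0 < s" and \<rho>: "0 < \<rho>" "\<rho> < 1"
    and w: "w \<in> borel_measurable lebesgue" "\<And>h. 0 \<le> w h" "\<And>h. w h \<le> B" "\<And>h. norm h < s \<Longrightarrow> w h = 0"
    and near: "\<And>h. norm h < \<rho> \<Longrightarrow> \<phi> (x0 + h) = \<phi> x0 + p \<bullet> h - A / 2 * (norm h)^2 + w h"
    and far: "\<And>h. \<rho> \<le> norm h \<Longrightarrow> \<phi> (x0 + h) = 0"
    and der: "frechet_derivative \<phi> (at x0) = (\<lambda>h. p \<bullet> h)"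
  shows "integrable lebesgue (\<lambda>h. w h * K h * indicator (ball 0 \<rho>) h)"
    and "nonlocal_op K \<phi> x0 = (\<integral>h. w h * K h * indicator (ball 0 \<rho>) h \<partial>lebesgue)
       - A / 2 * (\<integral>h. (norm h)^2 * K h * indicator (ball 0 \<rho>) h \<partial>lebesgue)
       - \<phi> x0 * (\<integral>h. K h * indicator (- ball 0 \<rho>) h \<partial>lebesgue)
       - p \<bullet> (LINT h:(ball 0 1 - ball 0 \<rho>)|lebesgue. K h *\<^sub>R h)"
proof -
  let ?w = "\<lambda>h. w h * K h * indicator (ball 0 \<rho>) h"
  let ?q = "\<lambda>h. (norm h)^2 * K h * indicator (ball 0 \<rho>) h"
  let ?o = "\<lambda>h. K h * indicator (- ball 0 \<rho>) h"
  let ?d = "\<lambda>h. indicator (ball 0 1 - ball 0 \<rho>) h *\<^sub>R (K h *\<^sub>R h)"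
  have wm: "?w \<in> borel_measurable lebesgue"
    using meas w(1) by (intro borel_measurable_times borel_measurable_indicator) auto
  have B: "0 \<le> B" using w(2,3)[of 0] by linarith
  have "norm (?w h) \<le> norm (B * (K h * indicator (- ball 0 s) h))" for h
  proof (cases "norm h < s")
    case True
    then show ?thesis using w(4)[of h] by simp
  next
    case False
    then have "h \<noteq> 0" using s by auto
    then have K0: "0 \<le> K h" by (rule nonneg)
    have "norm (?w h) \<le> w h * K h" using w(2)[of h] K0 by (auto simp: indicator_def)
    also have "\<dots> \<le> B * K h" using w(3)[of h] K0 by (rule mult_right_mono)
    finally show ?thesis using False B K0 by (simp add: indicator_def)
  qed
  then show wi: "integrable lebesgue ?w"
    by (intro Bochner_Integration.integrable_bound[OF integrable_mult_right[OF mass_outside(1)[OF s]] wm] AE_I2)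
  have qi: "integrable lebesgue ?q" by (rule second_moment_inside(1)[OF \<rho>(1)])
  have oi: "integrable lebesgue ?o" by (rule mass_outside(1)[OF \<rho>(1)])
  have di: "integrable lebesgue ?d"
    using first_moment_annulus(1)[OF \<rho>(1)] unfolding set_integrable_def .
  have eq: "(\<phi> (x0 + h) - \<phi> x0 - frechet_derivative \<phi> (at x0) h * indicator (ball 0 1) h) * K h
      = ?w h - A / 2 * ?q h - \<phi> x0 * ?o h - p \<bullet> ?d h" for h
  proof (cases "norm h < \<rho>")
    case True
    then show ?thesis using \<rho> unfolding der near[OF True] by (simp add: indicator_def algebra_simps)
  next
    case False
    then show ?thesis using \<rho> far[of h] unfolding der by (simp add: indicator_def algebra_simps)
  qed
  show "nonlocal_op K \<phi> x0 = (\<integral>h. ?w h \<partial>lebesgue) - A / 2 * (\<integral>h. ?q h \<partial>lebesgue)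
       - \<phi> x0 * (\<integral>h. ?o h \<partial>lebesgue) - p \<bullet> (LINT h:(ball 0 1 - ball 0 \<rho>)|lebesgue. K h *\<^sub>R h)"
    unfolding nonlocal_op_def eq set_lebesgue_integral_def
    by (simp only: Bochner_Integration.integral_diff integral_mult_right_zero integral_inner_right[OF di]
        Bochner_Integration.integrable_diff integrable_mult_right integrable_inner_right wi qi oi di)
qed

end

section \<open>Supersolutions have flat annuli\<close>

lemma slid_paraboloid_expand:
  "slid_paraboloid u A y x0 (x0 + h) = u x0 + (- A *\<^sub>R (x0 - y)) \<bullet> h - A / 2 * (norm h)^2"
proof -
  have eq: "(norm (x0 - y))^2 - (norm (x0 + h - y))^2 = - 2 * ((x0 - y) \<bullet> h) - (norm h)^2"
    unfolding power2_norm_eq_inner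
    by (simp add: inner_diff_left inner_diff_right inner_add_left inner_add_right inner_commute)
  show ?thesis unfolding slid_paraboloid_def eq by (simp add: algebra_simps)
qed

lemma slid_paraboloid_le:
  assumes "0 < A" "norm (x0 - y) \<le> 2 * \<rho>" "u x0 \<le> 2 * A * \<rho>^2"
  shows "slid_paraboloid u A y x0 x \<le> 4 * A * \<rho>^2"
proof -
  have "(norm (x0 - y))^2 \<le> (2 * \<rho>)^2" using assms by (intro power_mono) auto
  moreover have "(2 * \<rho>)^2 = 4 * \<rho>^2" by (simp add: power_mult_distrib)
  moreover have "0 \<le> (norm (x - y))^2" by simp
  ultimately have "(norm (x0 - y))^2 - (norm (x - y))^2 \<le> 4 * \<rho>^2" by linarith
  then have "A / 2 * ((norm (x0 - y))^2 - (norm (x - y))^2) \<le> A / 2 * (4 * \<rho>^2)"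
    using assms(1) by (intro mult_left_mono) auto
  then show ?thesis using assms(3) unfolding slid_paraboloid_def by simp
qed

lemma slid_paraboloid_has_derivative:
  "(slid_paraboloid u A y x0 has_derivative (\<lambda>h. (- A *\<^sub>R (x - y)) \<bullet> h)) (at x)"
  unfolding slid_paraboloid_def[abs_def] power2_norm_eq_inner
  by (auto intro!: derivative_eq_intros simp: inner_commute algebra_simps)

lemma C2_on_slid_paraboloid:
  assumes eq: "\<And>x. x \<in> S \<Longrightarrow> \<phi> x = slid_paraboloid u A y x0 x" and S: "open S"
  shows "C2_on S \<phi>"
  unfolding C2_on_def
proof (intro exI conjI ballI)
  let ?D = "\<lambda>x. - A *\<^sub>R blinfun_inner_right (x - y)"
  let ?D2 = "\<lambda>x. - A *\<^sub>R Blinfun blinfun_inner_right"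
  fix x assume x: "x \<in> S"
  show "(\<phi> has_derivative blinfun_apply (?D x)) (at x)"
    by (rule has_derivative_transform_within_open[OF slid_paraboloid_has_derivative[THEN has_derivative_eq_rhs] S x])
      (auto simp: eq scaleR_blinfun.rep_eq uminus_blinfun.rep_eq)
  have bl: "bounded_linear (blinfun_inner_right :: _ \<Rightarrow> _ \<Rightarrow>\<^sub>L real)" by (rule bounded_linear_blinfun_inner_right)
  have "(?D has_derivative (\<lambda>h. - A *\<^sub>R blinfun_inner_right h)) (at x)"
    by (auto intro!: derivative_eq_intros bounded_linear.has_derivative[OF bl])
  then show "(?D has_derivative blinfun_apply (?D2 x)) (at x)"
    by (rule has_derivative_eq_rhs)
      (auto simp: scaleR_blinfun.rep_eq uminus_blinfun.rep_eq bounded_linear_Blinfun_apply[OF bl])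
next
  show "continuous_on S (\<lambda>x. - A *\<^sub>R Blinfun blinfun_inner_right)" by (rule continuous_on_const)
qed

lemma borel_measurable_omega:
  fixes f :: "real^'n \<Rightarrow> real"
  shows "f \<in> borel_measurable (omega \<sigma>) \<longleftrightarrow> f \<in> borel_measurable lebesgue"
proof -
  have "sets (omega \<sigma> :: (real^'n) measure) = sets lebesgue" by (simp add: omega_def)
  then have "borel_measurable (omega \<sigma>) = (borel_measurable lebesgue :: (real^'n \<Rightarrow> real) set)"
    by (rule measurable_cong_sets) simp
  then show ?thesis by simp
qed

lemma integrable_omega_indicator_ball: "integrable (omega \<sigma>) (indicator (ball c r) :: real^'n \<Rightarrow> real)"
proof -
  have "emeasure (omega \<sigma>) (ball c r) \<le> emeasure lebesgue (ball c r)"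
  proof -
    have "(\<lambda>y :: real^'n. ennreal (min (norm y powr (- (real CARD('n) + \<sigma>))) 1)) \<in> borel_measurable borel"
      by measurable
    then have "emeasure (omega \<sigma>) (ball c r)
        = (\<integral>\<^sup>+y. ennreal (min (norm y powr (- (real CARD('n) + \<sigma>))) 1) * indicator (ball c r) y \<partial>lebesgue)"
      unfolding omega_def by (intro emeasure_density measurable_completion) auto
    also have "\<dots> \<le> (\<integral>\<^sup>+y. indicator (ball c r) y \<partial>lebesgue)"
      by (intro nn_integral_mono) (auto simp: indicator_def)
    finally show ?thesis by simp
  qed
  also have "\<dots> < \<infinity>" using lmeasurable_ball[of c r] unfolding fmeasurable_def by auto
  finally show ?thesis
    by (intro integrable_real_indicator) (auto simp: omega_def)
qed

lemma translation_lebesgue_measurable: "(\<lambda>h :: 'a::euclidean_space. x0 + h) \<in> lebesgue \<rightarrow>\<^sub>M lebesgue"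
  using lebesgue_affine_measurable[of "\<lambda>_. 1" x0] by (simp add: euclidean_representation)

text \<open>The test function is the paraboloid up to distance \<open>s\<close>, the minimum of \<open>u\<close> and \<open>B\<close> up to distance \<open>\<rho>\<close>, and \<open>0\<close>
  beyond. Truncation at \<open>B\<close> keeps it bounded, so that every integral converges without an
  estimate of the tail of \<open>u\<close>. The function \<open>w\<close> is its excess over the paraboloid. All other terms of the operator
  are at most constants times \<open>A \<rho>\<^bsup>2-\<sigma>\<^esup>\<close>: the gradient at \<open>x0\<close> has length at most \<open>2 A \<rho>\<close>, which is
  multiplied by the effective drift at scale \<open>\<rho>\<close>. The kernel may depend on \<open>s\<close>, since the infimum over the
  family is approached for each test function separately.\<close>

lemma contact_energy:
  fixes u f :: "real^'n \<Rightarrow> real"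
  assumes par: "0 < lam" "lam \<le> Lam" "0 < \<beta>" "1 \<le> \<sigma>" "\<sigma> < 2"
    and fam: "kernel_family \<sigma> lam Lam \<K>" "operator_family \<sigma> \<beta> \<K> \<L>"
    and u0: "\<And>x. 0 \<le> u x" and visc: "viscosity_supersolution \<sigma> \<L> (ball 0 1) u f"
    and x0: "x0 \<in> ball 0 1" and \<rho>: "0 < \<rho>" "\<rho> < 1" and s: "0 < s" "s \<le> \<rho>" and A: "0 < A"
    and xy: "norm (x0 - y) \<le> 2 * \<rho>" and ux0: "u x0 \<le> 2 * A * \<rho>^2" and fx0: "f x0 \<le> A * \<rho>^2"
    and touch: "\<And>x. slid_paraboloid u A y x0 x \<le> u x" and B: "4 * A * \<rho>^2 \<le> B"
    and w: "w = (\<lambda>h. if s \<le> norm h \<and> norm h < \<rho> then min (u (x0 + h)) B - slid_paraboloid u A y x0 (x0 + h) else 0)"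
  obtains K where "elliptic_kernel \<sigma> lam Lam K"
    "integrable lebesgue (\<lambda>h. w h * K h * indicator (ball 0 \<rho>) h)"
    "(\<integral>h. w h * K h * indicator (ball 0 \<rho>) h \<partial>lebesgue)
       \<le> (2 + 19 * Lam * kernel_const TYPE('n) + 10 * \<beta>) * A * \<rho> powr (2 - \<sigma>)"
proof -
  define P where "P = slid_paraboloid u A y x0"
  define p where "p = - A *\<^sub>R (x0 - y)"
  define C0 where "C0 = Lam * kernel_const TYPE('n)"
  have C0: "0 \<le> C0" using par by (simp add: C0_def)
  have Pexp: "P (x0 + h) = u x0 + p \<bullet> h - A / 2 * (norm h)^2" for h
    unfolding P_def p_def by (rule slid_paraboloid_expand)
  have PB: "P x \<le> B" for x unfolding P_def using slid_paraboloid_le[OF A xy, of u x] ux0 B by linarith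
  have P0: "P x0 = u x0" by (simp add: P_def slid_paraboloid_def)
  have B0: "0 \<le> B" using PB[of x0] P0 u0[of x0] by linarith
  have um: "u \<in> borel_measurable lebesgue"
    using visc unfolding viscosity_supersolution_def in_L1_omega_def
    by (auto dest!: borel_measurable_integrable simp: borel_measurable_omega)
  have Pm: "P \<in> borel_measurable lebesgue"
  proof -
    have "P \<in> borel_measurable borel"
      unfolding P_def slid_paraboloid_def[abs_def]
      by (intro borel_measurable_continuous_onI continuous_intros)
    then show ?thesis by (intro measurable_completion) simp
  qed
  define \<phi> where "\<phi> x = (if x \<in> ball x0 s then P x else if x \<in> ball x0 \<rho> then min (u x) B else 0)" for x
  have \<phi>0: "\<phi> x0 = u x0" using s P0 by (simp add: \<phi>_def)
  have \<phi>_le: "\<phi> x \<le> u x" for x using touch[of x] u0[of x] by (simp add: \<phi>_def P_def)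
  have \<phi>m: "\<phi> \<in> borel_measurable lebesgue"
    unfolding \<phi>_def[abs_def] using um Pm by (intro measurable_If borel_measurable_min) auto
  define Q where "Q = u x0 + norm p + A"
  have \<phi>_bound: "\<bar>\<phi> x\<bar> \<le> \<bar>u x\<bar> + Q * indicator (ball x0 s) x" for x
  proof (cases "x \<in> ball x0 s")
    case True
    define h where "h = x - x0"
    have x: "x = x0 + h" by (simp add: h_def)
    have h: "norm h \<le> 1" using True s \<rho> by (simp add: h_def dist_norm norm_minus_commute)
    have "\<bar>p \<bullet> h\<bar> \<le> norm p * norm h" by (rule Cauchy_Schwarz_ineq2)
    also have "\<dots> \<le> norm p" using h by (intro mult_left_le) auto
    finally have "\<bar>p \<bullet> h\<bar> \<le> norm p" .
    moreover have "A / 2 * (norm h)^2 \<le> A / 2 * 1" "0 \<le> A / 2 * (norm h)^2"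
      using h A by (auto intro!: mult_left_mono simp: power_le_one)
    ultimately have "\<bar>P x\<bar> \<le> Q" unfolding x Pexp Q_def using u0[of x0] A by linarith
    then show ?thesis using True by (simp add: \<phi>_def)
  next
    case False
    then show ?thesis using u0[of x] B0 by (simp add: \<phi>_def)
  qed
  have "in_L1_omega \<sigma> \<phi>"
    unfolding in_L1_omega_def
  proof (rule Bochner_Integration.integrable_bound)
    show "integrable (omega \<sigma>) (\<lambda>x. \<bar>u x\<bar> + Q * indicator (ball x0 s) x)"
      using visc integrable_omega_indicator_ball[of \<sigma> x0 s]
      unfolding viscosity_supersolution_def in_L1_omega_def by auto
    show "\<phi> \<in> borel_measurable (omega \<sigma>)" using \<phi>m by (simp add: borel_measurable_omega)
    show "AE x in omega \<sigma>. norm (\<phi> x) \<le> norm (\<bar>u x\<bar> + Q * indicator (ball x0 s) x)"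
      using \<phi>_bound by (intro AE_I2) (auto intro: order_trans[OF _ abs_ge_self])
  qed
  moreover have "C2_on (ball x0 s) \<phi>"
    by (rule C2_on_slid_paraboloid[of _ _ u A y x0]) (auto simp: \<phi>_def P_def)
  ultimately have "test_function \<sigma> \<phi> x0 s" using s unfolding test_function_def by simp
  moreover have "touches_below \<phi> u x0" unfolding touches_below_def using \<phi>0 \<phi>_le by simp
  ultimately have "extremal_minus \<L> \<phi> x0 \<le> ereal (f x0)"
    using visc x0 unfolding viscosity_supersolution_def by blast
  also have "ereal (f x0) < ereal (2 * A * \<rho>^2)"
  proof -
    have "0 < A * \<rho>^2" using A \<rho> by simp
    then show ?thesis using fx0 by simp
  qed
  finally obtain L where L: "L \<in> \<L>" "L \<phi> x0 < 2 * A * \<rho>^2"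
    unfolding extremal_minus_def by (auto simp: INF_less_iff)
  then obtain K b where Kb: "K \<in> \<K>" "L = drift_op K b" "drift_bound \<sigma> \<beta> K b"
    using fam(2) unfolding operator_family_def by blast
  interpret elliptic_kernel \<sigma> lam Lam K
    using fam(1) Kb(1) par unfolding kernel_family_def by unfold_locales auto
  have wm: "w \<in> borel_measurable lebesgue"
  proof -
    have "(\<lambda>h. u (x0 + h)) \<in> borel_measurable lebesgue" "(\<lambda>h. P (x0 + h)) \<in> borel_measurable lebesgue"
      using measurable_compose[OF translation_lebesgue_measurable um] measurable_compose[OF translation_lebesgue_measurable Pm]
      by auto
    moreover have "{h :: real^'n. s \<le> norm h \<and> norm h < \<rho>} \<in> sets lebesgue"
    proof -
      have "{h :: real^'n. s \<le> norm h \<and> norm h < \<rho>} = ball 0 \<rho> - ball 0 s" by auto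
      then show ?thesis by simp
    qed
    ultimately show ?thesis unfolding w P_def[symmetric]
      by (intro measurable_If borel_measurable_diff borel_measurable_min) auto
  qed
  have w0: "0 \<le> w h" for h
    using touch[of "x0 + h"] PB[of "x0 + h"] unfolding w P_def by auto
  have wB: "w h \<le> B + norm p + A" for h
  proof (cases "s \<le> norm h \<and> norm h < \<rho>")
    case True
    have "\<bar>p \<bullet> h\<bar> \<le> norm p * norm h" by (rule Cauchy_Schwarz_ineq2)
    also have "\<dots> \<le> norm p" using True \<rho> by (intro mult_left_le) auto
    finally have "\<bar>p \<bullet> h\<bar> \<le> norm p" .
    moreover have "A / 2 * (norm h)^2 \<le> A / 2 * 1"
      using True \<rho> A by (intro mult_left_mono) (auto simp: power_le_one)
    ultimately have "- P (x0 + h) \<le> norm p + A" unfolding Pexp using u0[of x0] A by linarith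
    then show ?thesis using True unfolding w P_def by (simp add: min_def)
  next
    case False
    then show ?thesis using B0 A norm_ge_zero[of p] unfolding w by auto
  qed
  have der: "frechet_derivative \<phi> (at x0) = (\<lambda>h. p \<bullet> h)"
  proof (rule frechet_derivative_at[symmetric])
    have "(P has_derivative (\<lambda>h. p \<bullet> h)) (at x0)"
      unfolding P_def p_def by (rule slid_paraboloid_has_derivative)
    then show "(\<phi> has_derivative (\<lambda>h. p \<bullet> h)) (at x0)"
      by (rule has_derivative_transform_within_open[of _ _ _ _ "ball x0 s"]) (use s in \<open>auto simp: \<phi>_def\<close>)
  qed
  have near: "\<phi> (x0 + h) = \<phi> x0 + p \<bullet> h - A / 2 * (norm h)^2 + w h" if "norm h < \<rho>" for h
    using that Pexp[of h] unfolding \<phi>0 w P_def[symmetric] by (auto simp: \<phi>_def dist_norm)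
  have far: "\<phi> (x0 + h) = 0" if "\<rho> \<le> norm h" for h
    using that s by (simp add: \<phi>_def dist_norm)
  have ws: "w h = 0" if "norm h < s" for h using that unfolding w by simp
  note trunc = nonlocal_op_truncated[OF s(1) \<rho> wm w0 wB ws near far der]
  define IW where "IW = (\<integral>h. w h * K h * indicator (ball 0 \<rho>) h \<partial>lebesgue)"
  define IQ where "IQ = (\<integral>h. (norm h)^2 * K h * indicator (ball 0 \<rho>) h \<partial>lebesgue)"
  define IO where "IO = (\<integral>h. K h * indicator (- ball 0 \<rho>) h \<partial>lebesgue)"
  define I1 where "I1 = (LINT h:(ball 0 1 - ball 0 \<rho>)|lebesgue. K h *\<^sub>R h)"
  have Leq: "L \<phi> x0 = IW - A / 2 * IQ - u x0 * IO + p \<bullet> (b - I1)"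
    using trunc(2) unfolding Kb(2) drift_op_def der \<phi>0 IW_def IQ_def IO_def I1_def
    by (simp add: inner_diff_right)
  define R where "R = \<rho> powr (2 - \<sigma>)"
  have R: "0 < R" using \<rho> by (simp add: R_def)
  have pow: "\<rho>^2 * \<rho> powr (- \<sigma>) = R" "\<rho> * \<rho> powr (1 - \<sigma>) = R" "\<rho>^2 \<le> R"
  proof -
    have "\<rho>^2 * \<rho> powr (- \<sigma>) = \<rho> powr 2 * \<rho> powr (- \<sigma>)" using \<rho> by simp
    also have "\<dots> = R" unfolding R_def by (simp only: powr_add[symmetric]) simp
    finally show "\<rho>^2 * \<rho> powr (- \<sigma>) = R" .
    have "\<rho> * \<rho> powr (1 - \<sigma>) = \<rho> powr 1 * \<rho> powr (1 - \<sigma>)" using \<rho> by simp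
    also have "\<dots> = R" unfolding R_def by (simp only: powr_add[symmetric]) simp
    finally show "\<rho> * \<rho> powr (1 - \<sigma>) = R" .
    have "\<rho> powr 2 \<le> \<rho> powr (2 - \<sigma>)" using \<rho> par by (intro powr_mono') auto
    then show "\<rho>^2 \<le> R" using \<rho> by (simp add: R_def)
  qed
  have "A / 2 * IQ \<le> A / 2 * (C0 * R)"
    using second_moment_inside(2)[OF \<rho>(1)] A unfolding IQ_def C0_def R_def by (intro mult_left_mono) auto
  moreover have "u x0 * IO \<le> 2 * A * C0 * R"
  proof -
    have "u x0 * IO \<le> u x0 * (C0 * \<rho> powr (- \<sigma>))"
      using mass_outside(2)[OF \<rho>(1)] u0[of x0] unfolding IO_def C0_def by (intro mult_left_mono) auto
    also have "\<dots> \<le> 2 * A * \<rho>^2 * (C0 * \<rho> powr (- \<sigma>))"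
      using ux0 C0 by (intro mult_right_mono) auto
    also have "\<dots> = 2 * A * C0 * R" unfolding pow(1)[symmetric] by (simp only: mult_ac)
    finally show ?thesis .
  qed
  moreover have "- (p \<bullet> (b - I1)) \<le> 2 * A * (5 * \<beta> + 8 * C0) * R"
  proof -
    have "- (p \<bullet> (b - I1)) \<le> norm p * norm (b - I1)"
      using Cauchy_Schwarz_ineq2[of p "b - I1"] by linarith
    also have "\<dots> \<le> (A * (2 * \<rho>)) * ((5 * \<beta> + 8 * C0) * \<rho> powr (1 - \<sigma>))"
    proof (rule mult_mono)
      show "norm p \<le> A * (2 * \<rho>)" unfolding p_def using A xy by simp
      show "norm (b - I1) \<le> (5 * \<beta> + 8 * C0) * \<rho> powr (1 - \<sigma>)"
        using effective_drift_bound[OF Kb(3) \<rho> par(3)] unfolding I1_def C0_def by (simp only: mult.assoc)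
    qed (use A \<rho> in auto)
    also have "\<dots> = 2 * A * (5 * \<beta> + 8 * C0) * R" unfolding pow(2)[symmetric] by (simp only: mult_ac)
    finally show ?thesis .
  qed
  moreover have "L \<phi> x0 \<le> 2 * A * R"
  proof -
    have "2 * A * \<rho>^2 \<le> 2 * A * R" using pow(3) A by (intro mult_left_mono) auto
    then show ?thesis using L(2) by linarith
  qed
  ultimately have "IW \<le> 2 * A * R + A / 2 * (C0 * R) + 2 * A * C0 * R + 2 * A * (5 * \<beta> + 8 * C0) * R"
    using Leq by linarith
  also have "\<dots> \<le> (2 + 19 * C0 + 10 * \<beta>) * A * R"
  proof -
    have "0 \<le> A * C0 * R" using A C0 R by simp
    then show ?thesis by (simp add: algebra_simps)
  qed
  finally have "IW \<le> (2 + 19 * C0 + 10 * \<beta>) * A * R" .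
  then show thesis
    using that[of K] trunc(1) elliptic_kernel_axioms unfolding IW_def C0_def R_def by (simp add: mult.assoc)
qed

lemma fmeasurable_of_measure_pos:
  assumes "0 < measure M T"
  shows "T \<in> fmeasurable M"
proof (rule fmeasurableI)
  show "T \<in> sets M" using assms measure_notin_sets[of T M] by (cases "T \<in> sets M") auto
  show "emeasure M T < \<infinity>" using assms unfolding measure_def enn2real_positive_iff by simp
qed

text \<open>The weight \<open>a = 2 - \<sigma>\<close> tends to \<open>0\<close> as \<open>\<sigma>\<close> tends to \<open>2\<close>, but then the number of annuli that count grows
  like \<open>1 / a\<close>. This is what makes the constants uniform in \<open>\<sigma>\<close>.\<close>

lemma scale_weights_lower_bound:
  fixes a :: real
  assumes a: "0 < a"
  obtains m :: nat where "1 / 80 \<le> a * (\<Sum>k<m. (40 powr (- a)) ^ k)"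
proof -
  define q where "q = (40::real) powr (- a)"
  have q: "0 < q" "q < 1" using a by (simp_all add: q_def powr_less_one)
  obtain m where m: "q ^ m < 1 / 2" using real_arch_pow_inv[of "1/2" q] q by auto
  have "1 - q \<le> a * ln 40"
  proof -
    have "1 + (- a * ln 40) \<le> exp (- a * ln 40)" by (rule exp_ge_add_one_self)
    then show ?thesis by (simp add: q_def powr_def)
  qed
  also have "\<dots> \<le> a * 40" using ln_le_minus_one[of "40::real"] a by (intro mult_left_mono) auto
  finally have q40: "1 - q \<le> 40 * a" by simp
  have "1 / 80 * (1 - q) \<le> a * (1 / 2)" using q40 by simp
  also have "\<dots> \<le> a * (1 - q ^ m)" using m a by (intro mult_left_mono) auto
  also have "\<dots> = a * (\<Sum>k<m. q ^ k) * (1 - q)"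
    using q one_diff_power_eq[of q m] by (simp add: mult_ac)
  finally have "1 / 80 \<le> a * (\<Sum>k<m. q ^ k)" by (rule mult_right_le_imp_le) (use q in simp)
  then show ?thesis using that unfolding q_def by blast
qed

text \<open>If every annulus of radius \<open>r = \<rho> / 40\<^sup>k\<close> had many high points, then \<open>w \<ge> M A r\<^sup>2\<close> on a set of measure at
  least \<open>\<kappa> r\<^sup>n\<close>, where the kernel is at least \<open>\<lambda> (2 - \<sigma>) r\<^bsup>-(n+\<sigma>)\<^esup>\<close>. Summing the contributions
  \<open>\<lambda> \<kappa> M A (2 - \<sigma>) r\<^bsup>2-\<sigma>\<^esup>\<close> over \<open>k\<close> contradicts \<open>contact_energy\<close> for large \<open>M\<close>. Finitely many annuli suffice,
  so the paraboloid piece of the test function can be chosen smaller than all of them.\<close>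

lemma supersolution_has_flat_annuli:
  fixes lam Lam \<beta> :: real
  assumes par: "0 < lam" "lam \<le> Lam" "0 < \<beta>"
  obtains M where "0 < M"
    "\<And>\<sigma> \<K> \<L> (u :: real^'n \<Rightarrow> real) f F. 1 \<le> \<sigma> \<Longrightarrow> \<sigma> < 2 \<Longrightarrow> kernel_family \<sigma> lam Lam \<K> \<Longrightarrow>
      operator_family \<sigma> \<beta> \<K> \<L> \<Longrightarrow> (\<And>x. 0 \<le> u x) \<Longrightarrow> viscosity_supersolution \<sigma> \<L> (ball 0 1) u f \<Longrightarrow>
      (\<And>x. x \<in> ball 0 1 \<Longrightarrow> f x \<le> F) \<Longrightarrow> has_flat_annuli M F u"
proof -
  define n where "n = CARD('n)"
  define V where "V = vol TYPE(real^'n)"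
  have n_eq: "CARD('n) = n" "unit_ball_vol (real n) = V" by (simp_all add: n_def V_def)
  have V: "0 < V" by (simp add: V_def)
  define \<kappa> where "\<kappa> = V / 2 * (1 / 80) ^ n"
  have \<kappa>: "0 < \<kappa>" using V by (simp add: \<kappa>_def)
  define C1 where "C1 = 2 + 19 * Lam * kernel_const TYPE('n) + 10 * \<beta>"
  have C1: "0 < C1" unfolding C1_def using par by (intro add_pos_pos add_pos_nonneg) auto
  define M where "M = 80 * (C1 + 1) / (lam * \<kappa>)"
  have M: "0 < M" using C1 \<kappa> par by (simp add: M_def)
  show thesis
  proof (rule that[OF M])
    fix \<sigma> \<K> \<L> and u f :: "real^'n \<Rightarrow> real" and F :: real
    assume \<sigma>: "1 \<le> \<sigma>" "\<sigma> < 2" and fam: "kernel_family \<sigma> lam Lam \<K>" "operator_family \<sigma> \<beta> \<K> \<L>"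
      and u0: "\<And>x. 0 \<le> u x" and visc: "viscosity_supersolution \<sigma> \<L> (ball 0 1) u f"
      and F: "\<And>x. x \<in> ball 0 1 \<Longrightarrow> f x \<le> F"
    show "has_flat_annuli M F u"
      unfolding has_flat_annuli_def
    proof (intro allI impI)
      fix x0 y :: "real^'n" and A \<rho> :: real
      assume x0: "norm x0 < 1" and \<rho>: "0 < \<rho>" "\<rho> < 1" and A: "0 < A"
        and xy: "norm (x0 - y) \<le> 2 * \<rho>" and ux0: "u x0 \<le> 2 * A * \<rho>^2" and FA: "F \<le> A * \<rho>^2"
        and touch: "\<forall>x. slid_paraboloid u A y x0 x \<le> u x"
      define P where "P = slid_paraboloid u A y x0"
      define a where "a = 2 - \<sigma>"
      have a: "0 < a" using \<sigma> by (simp add: a_def)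
      obtain m where m: "1 / 80 \<le> a * (\<Sum>k<m. (40 powr (- a)) ^ k)"
        using scale_weights_lower_bound[OF a] .
      define r where "r k = \<rho> / 40 ^ k" for k :: nat
      have r: "0 < r k" "r k \<le> \<rho>" for k
        using \<rho> by (auto simp: r_def divide_le_eq intro!: mult_left_le one_le_power)
      have r_anti: "r l \<le> r k" if "k \<le> l" for k l
        unfolding r_def using that \<rho> by (intro divide_left_mono power_increasing) auto
      have r_Suc: "r (Suc k) = r k / 40" for k by (simp add: r_def)
      show "\<exists>r. 0 < r \<and> r \<le> \<rho> \<and> few_high_points M u A y x0 r"
      proof (rule ccontr)
        assume "\<not> ?thesis"
        then have many: "\<not> few_high_points M u A y x0 (r k)" for k using r by blast
        define Q where "Q k = {h. r k / 40 \<le> norm h \<and> norm h < r k \<and> P (x0 + h) + M * A * (r k)^2 < u (x0 + h)}" for k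
        define B where "B = (4 + M) * (A * \<rho>^2)"
        have A\<rho>: "0 < A * \<rho>^2" using A \<rho> by simp
        have B4: "4 * A * \<rho>^2 \<le> B" using M A\<rho> by (simp add: B_def distrib_right)
        define s where "s = r m"
        have s: "0 < s" "s \<le> \<rho>" using r by (simp_all add: s_def)
        define w where "w h = (if s \<le> norm h \<and> norm h < \<rho> then min (u (x0 + h)) B - P (x0 + h) else 0)" for h
        have fx0: "f x0 \<le> A * \<rho>^2" using F[of x0] x0 FA by simp
        have x0': "x0 \<in> ball 0 1" using x0 by simp
        obtain K where K: "elliptic_kernel \<sigma> lam Lam K"
            "integrable lebesgue (\<lambda>h. w h * K h * indicator (ball 0 \<rho>) h)"
            "(\<integral>h. w h * K h * indicator (ball 0 \<rho>) h \<partial>lebesgue) \<le> C1 * A * \<rho> powr a"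
          using contact_energy[OF par \<sigma> fam u0 visc x0' \<rho> s A xy ux0 fx0 touch[rule_format] B4, of w]
          unfolding w_def P_def C1_def a_def by blast
        interpret elliptic_kernel \<sigma> lam Lam K by (rule K(1))
        have Q_lm: "Q k \<in> lmeasurable" and Q_big: "\<kappa> * r k ^ n \<le> measure lebesgue (Q k)" for k
        proof -
          let ?T = "{x. r k / 40 \<le> norm (x - x0) \<and> norm (x - x0) < r k \<and> P x + M * A * (r k)^2 < u x}"
          have "V / 2 * (r k / 80) ^ n < measure lebesgue ?T"
            using many[of k] unfolding few_high_points_def P_def by (simp add: n_eq)
          moreover have "V / 2 * (r k / 80) ^ n = \<kappa> * r k ^ n"
            by (simp add: \<kappa>_def power_divide)
          ultimately have big: "\<kappa> * r k ^ n < measure lebesgue ?T" by linarith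
          have "0 < \<kappa> * r k ^ n" using \<kappa> r(1)[of k] by simp
          then have pos: "0 < measure lebesgue ?T" using big by linarith
          then have T: "?T \<in> lmeasurable" by (rule fmeasurable_of_measure_pos)
          have Q: "Q k = (+) (- x0) ` ?T"
          proof (rule set_eqI)
            fix h
            have "h \<in> Q k \<longleftrightarrow> x0 + h \<in> ?T" by (simp add: Q_def)
            also have "\<dots> \<longleftrightarrow> h \<in> (+) (- x0) ` ?T"
            proof
              assume "x0 + h \<in> ?T"
              then show "h \<in> (+) (- x0) ` ?T" by (rule rev_image_eqI) simp
            next
              assume "h \<in> (+) (- x0) ` ?T"
              then show "x0 + h \<in> ?T" by fastforce
            qed
            finally show "h \<in> Q k \<longleftrightarrow> h \<in> (+) (- x0) ` ?T" .
          qed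
          show "Q k \<in> lmeasurable" unfolding Q using T by (rule measurable_translation)
          show "\<kappa> * r k ^ n \<le> measure lebesgue (Q k)" unfolding Q measure_translation by (rule less_imp_le[OF big])
        qed
        define c where "c k = M * A * (r k)^2 * (lam * a * r k powr (- (real n + \<sigma>)))" for k
        have c0: "0 \<le> c k" for k unfolding c_def using M A par a by (intro mult_nonneg_nonneg) auto
        have Q_disj: "j = k" if "h \<in> Q j" "h \<in> Q k" for h j k
        proof -
          have "\<not> j < k" if "h \<in> Q j" "h \<in> Q k" for j k
            using that r_anti[of "Suc j" k] r_Suc[of j] by (auto simp: Q_def)
          then show ?thesis using that by (meson linorder_neqE_nat)
        qed
        have P_le: "P x \<le> 4 * A * \<rho>^2" for x
          unfolding P_def by (rule slid_paraboloid_le[OF A xy]) (rule ux0)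
        have w0: "0 \<le> w h" for h
        proof -
          have "P (x0 + h) \<le> 4 * A * \<rho>^2" by (rule P_le)
          then show ?thesis using touch[rule_format, of "x0 + h"] B4 unfolding w_def P_def by auto
        qed
        have pointwise: "(\<Sum>k<m. c k * indicator (Q k) h) \<le> w h * K h * indicator (ball 0 \<rho>) h" for h
        proof (cases "\<exists>k<m. h \<in> Q k")
          case True
          then obtain j where j: "j < m" "h \<in> Q j" by blast
          have "(\<Sum>k<m. c k * indicator (Q k) h) = (\<Sum>k<m. if k = j then c j else 0)"
            using j Q_disj by (intro sum.cong) (auto simp: indicator_def)
          also have "\<dots> = c j" using j by simp
          also have "\<dots> \<le> w h * K h"
            unfolding c_def
          proof (rule mult_mono)
            have h: "r j / 40 \<le> norm h" "norm h < r j" "P (x0 + h) + M * A * (r j)^2 < u (x0 + h)"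
              using j(2) by (auto simp: Q_def)
            have "s \<le> norm h" using r_anti[of "Suc j" m] j(1) h(1) by (simp add: s_def r_Suc)
            moreover have "norm h < \<rho>" using h(2) r(2)[of j] by linarith
            moreover have "P (x0 + h) + M * A * (r j)^2 \<le> B"
            proof -
              have "M * A * (r j)^2 \<le> M * A * \<rho>^2"
                using r[of j] M A by (intro mult_left_mono power_mono) auto
              moreover have "P (x0 + h) \<le> 4 * A * \<rho>^2" by (rule P_le)
              ultimately show ?thesis by (simp add: B_def distrib_right)
            qed
            ultimately show "M * A * (r j)^2 \<le> w h" using h(3) unfolding w_def by auto
            have hn: "h \<noteq> 0" using h(1) r(1)[of j] by auto
            have "norm h < 1" using \<open>norm h < \<rho>\<close> \<rho> by linarith
            then have "K_minus \<sigma> lam h = lam * a * norm h powr (- (real n + \<sigma>))"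
              by (simp add: K_minus_def n_def a_def)
            moreover have "r j powr (- (real n + \<sigma>)) \<le> norm h powr (- (real n + \<sigma>))"
              using h(2) hn \<sigma> by (intro powr_mono2') auto
            then have "lam * a * r j powr (- (real n + \<sigma>)) \<le> lam * a * norm h powr (- (real n + \<sigma>))"
              using par a by (intro mult_left_mono) auto
            ultimately show "lam * a * r j powr (- (real n + \<sigma>)) \<le> K h" using lower[OF hn] by linarith
          qed (use w0 par a in auto)
          also have "\<dots> = w h * K h * indicator (ball 0 \<rho>) h"
            using j(2) r(2)[of j] by (auto simp: Q_def)
          finally show ?thesis .
        next
          case False
          then have "(\<Sum>k<m. c k * indicator (Q k) h) = 0" by (intro sum.neutral) auto
          moreover have "0 \<le> w h * K h"
          proof (cases "h = 0")
            case True
            then show ?thesis using s by (simp add: w_def)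
          next
            case False
            then show ?thesis using w0 nonneg by simp
          qed
          then have "0 \<le> w h * K h * indicator (ball 0 \<rho>) h" by simp
          ultimately show ?thesis by simp
        qed
        have Qi: "integrable lebesgue (\<lambda>h. c k * indicator (Q k) h)" for k
          using Q_lm[of k] by (auto simp: fmeasurable_def)
        have "(C1 + 1) * A * \<rho> powr a = M * A * lam * \<kappa> * \<rho> powr a * (1 / 80)"
          using par \<kappa> by (simp add: M_def)
        also have "\<dots> \<le> M * A * lam * \<kappa> * \<rho> powr a * (a * (\<Sum>k<m. (40 powr (- a)) ^ k))"
          using m M A par \<kappa> by (intro mult_left_mono) auto
        also have "\<dots> = (\<Sum>k<m. c k * (\<kappa> * r k ^ n))"
          unfolding sum_distrib_left
        proof (rule sum.cong)
          fix k
          have r_pow: "(r k)^2 * r k powr (- (real n + \<sigma>)) * r k ^ n = \<rho> powr a * (40 powr (- a)) ^ k"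
          proof -
            have "(r k)^2 * r k powr (- (real n + \<sigma>)) * r k ^ n
                = r k powr 2 * r k powr (- (real n + \<sigma>)) * r k powr (real n)"
              using r(1)[of k] by (simp add: powr_realpow)
            also have "\<dots> = r k powr a" by (simp only: powr_add[symmetric]) (simp add: a_def)
            also have "\<dots> = \<rho> powr a * (40 powr (- a)) ^ k"
            proof -
              have "((40::real) ^ k) powr (- a) = (40 powr (- a)) ^ k"
                by (simp add: powr_realpow[symmetric] powr_powr powr_power mult_ac)
              then show ?thesis using \<rho> unfolding r_def by (simp add: powr_divide powr_minus field_simps)
            qed
            finally show ?thesis .
          qed
          have "M * A * lam * \<kappa> * \<rho> powr a * (a * (40 powr (- a)) ^ k)
              = M * A * lam * \<kappa> * a * (\<rho> powr a * (40 powr (- a)) ^ k)" by (simp only: mult_ac)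
          also have "\<dots> = c k * (\<kappa> * r k ^ n)"
            unfolding r_pow[symmetric] c_def by (simp only: mult_ac)
          finally show "M * A * lam * \<kappa> * \<rho> powr a * (a * (40 powr (- a)) ^ k) = c k * (\<kappa> * r k ^ n)" .
        qed simp
        also have "\<dots> \<le> (\<Sum>k<m. c k * measure lebesgue (Q k))"
          using Q_big c0 by (intro sum_mono mult_left_mono) auto
        also have "\<dots> = (\<Sum>k<m. \<integral>h. c k * indicator (Q k) h \<partial>lebesgue)"
          using Q_lm by (intro sum.cong) (auto simp: fmeasurable_def)
        also have "\<dots> = (\<integral>h. (\<Sum>k<m. c k * indicator (Q k) h) \<partial>lebesgue)"
          by (rule Bochner_Integration.integral_sum[symmetric]) (rule Qi)
        also have "\<dots> \<le> (\<integral>h. w h * K h * indicator (ball 0 \<rho>) h \<partial>lebesgue)"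
          by (rule integral_mono[OF Bochner_Integration.integrable_sum[OF Qi] K(2)]) (rule pointwise)
        also note K(3)
        finally have "(C1 + 1) * A * \<rho> powr a \<le> C1 * A * \<rho> powr a" .
        moreover have "0 < A * \<rho> powr a" using A \<rho> by simp
        ultimately show False by (simp add: distrib_right)
      qed
    qed
  qed
qed

section \<open>The weak Harnack estimate\<close>

theorem theorem4p4:
  fixes lam Lam \<beta> :: real
  assumes "0 < lam" and "lam \<le> Lam" and "0 < \<beta>"
  shows "\<exists>\<epsilon> C :: real. 0 < \<epsilon> \<and> 0 < C \<and>
    (\<forall>(\<sigma>::real) (\<K> :: (real^'n \<Rightarrow> real) set) \<L> (u :: real^'n \<Rightarrow> real) (f :: real^'n \<Rightarrow> real).
       1 \<le> \<sigma> \<longrightarrow> \<sigma> < 2 \<longrightarrow>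
       kernel_family \<sigma> lam Lam \<K> \<longrightarrow>
       operator_family \<sigma> \<beta> \<K> \<L> \<longrightarrow>
       (\<forall>x. 0 \<le> u x) \<longrightarrow>
       viscosity_supersolution \<sigma> \<L> (ball 0 1) u f \<longrightarrow>
       (\<forall>t>0.
          emeasure lebesgue ({x. u x > t} \<inter> ball 0 (1/4))
            / emeasure lebesgue (ball (0 :: real^'n) (1/4))
          \<le> ennreal C
            * ennreal_powr
                (sup_pos (ball 0 1) f + ennreal (INF x\<in>ball 0 (1/2). u x)) \<epsilon>
            * ennreal (t powr (- \<epsilon>))))"
proof -
  define n where "n = CARD('n)"
  define V where "V = vol TYPE(real^'n)"
  have n_eq: "DIM(real^'n) = n" "unit_ball_vol (real n) = V" by (simp_all add: n_def V_def)
  have V: "0 < V" by (simp add: V_def)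
  have n1: "1 \<le> n" unfolding n_def by (simp add: Suc_leI)
  obtain M where M: "0 < M"
    "\<And>\<sigma> \<K> \<L> (u :: real^'n \<Rightarrow> real) f F. 1 \<le> \<sigma> \<Longrightarrow> \<sigma> < 2 \<Longrightarrow> kernel_family \<sigma> lam Lam \<K> \<Longrightarrow>
      operator_family \<sigma> \<beta> \<K> \<L> \<Longrightarrow> (\<And>x. 0 \<le> u x) \<Longrightarrow> viscosity_supersolution \<sigma> \<L> (ball 0 1) u f \<Longrightarrow>
      (\<And>x. x \<in> ball 0 1 \<Longrightarrow> f x \<le> F) \<Longrightarrow> has_flat_annuli M F u"
    by (rule supersolution_has_flat_annuli[OF assms]) blast
  obtain M' d :: real where M': "1 < M'" and d: "0 < d" "d \<le> 1" and low:
    "\<And>F (u :: real^'n \<Rightarrow> real) z \<rho> m xs.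
      has_flat_annuli M F u \<Longrightarrow> lower_semicontinuous_on (ball 0 1) u \<Longrightarrow> u \<in> borel_measurable lebesgue \<Longrightarrow>
      (\<And>x. 0 \<le> u x) \<Longrightarrow> 0 < \<rho> \<Longrightarrow> norm z + \<rho> \<le> 1 / 2 \<Longrightarrow> norm (xs - z) \<le> \<rho> \<Longrightarrow> 0 < m \<Longrightarrow>
      u xs \<le> m \<Longrightarrow> F \<le> m \<Longrightarrow>
      d * (vol TYPE(real^'n) * \<rho> ^ DIM(real^'n)) \<le> measure lebesgue (cball z \<rho> \<inter> {x. u x \<le> M' * m})"
    by (rule low_set_density[OF M(1), where 'a="real^'n"]) blast
  define q where "q = 1 - d / 5 ^ n"
  have q: "0 < q" "q < 1"
  proof -
    have "d / 5 ^ n \<le> 1 / 5 ^ n" using d by (intro divide_right_mono) auto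
    also have "\<dots> \<le> 1 / 5 ^ 1" using n1 by (intro divide_left_mono power_increasing) auto
    also have "\<dots> < (1::real)" by simp
    finally show "0 < q" by (simp only: q_def diff_gt_0_iff_gt)
  qed (use d in \<open>simp add: q_def\<close>)
  define \<epsilon> where "\<epsilon> = - ln q / ln M'"
  have \<epsilon>: "0 < \<epsilon>" unfolding \<epsilon>_def using q M' by (intro divide_pos_pos) auto
  define C where "C = 2 ^ n * M' powr \<epsilon>"
  have C: "0 < C" using M' by (simp add: C_def)
  show ?thesis
  proof (intro exI conjI allI impI)
    show "0 < \<epsilon>" "0 < C" by fact+
  next
    fix \<sigma> \<K> \<L> and u f :: "real^'n \<Rightarrow> real" and t :: real
    assume \<sigma>: "1 \<le> \<sigma>" "\<sigma> < 2" and fam: "kernel_family \<sigma> lam Lam \<K>" "operator_family \<sigma> \<beta> \<K> \<L>"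
      and u0: "\<forall>x. 0 \<le> u x" and visc: "viscosity_supersolution \<sigma> \<L> (ball 0 1) u f" and t: "0 < t"
    define i where "i = (INF x\<in>ball 0 (1/2). u x)"
    have i0: "0 \<le> i" unfolding i_def using u0 by (intro cINF_greatest) auto
    show "emeasure lebesgue ({x. u x > t} \<inter> ball 0 (1/4)) / emeasure lebesgue (ball (0 :: real^'n) (1/4))
          \<le> ennreal C * ennreal_powr (sup_pos (ball 0 1) f + ennreal (INF x\<in>ball 0 (1/2). u x)) \<epsilon>
            * ennreal (t powr (- \<epsilon>))"
    proof (cases "sup_pos (ball 0 1) f = top")
      case True
      then show ?thesis using C t by (simp add: ennreal_powr_def ennreal_mult_top ennreal_top_mult)
    next
      case False
      define F where "F = enn2real (sup_pos (ball 0 1) f)"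
      have F0: "0 \<le> F" by (simp add: F_def)
      have supF: "sup_pos (ball 0 1) f = ennreal F" using False by (simp add: F_def less_top)
      have fF: "f x \<le> F" if "x \<in> ball 0 1" for x
      proof -
        have "ennreal (max (f x) 0) \<le> ennreal F"
          unfolding supF[symmetric] sup_pos_def by (rule SUP_upper[OF that])
        then show ?thesis using F0 by (simp add: ennreal_le_iff)
      qed
      have flat: "has_flat_annuli M F u"
        by (rule M(2)[OF \<sigma> fam _ visc fF]) (use u0 in auto)
      have um: "u \<in> borel_measurable lebesgue"
        using visc unfolding viscosity_supersolution_def in_L1_omega_def
        by (auto dest!: borel_measurable_integrable simp: borel_measurable_omega)
      have lsc: "lower_semicontinuous_on (ball 0 1) u"
        using visc unfolding viscosity_supersolution_def by blast
      define \<mu> where "\<mu> s = measure lebesgue {x \<in> ball 0 (1 / 2). s < u x}" for s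
      have lm: "{x \<in> ball 0 (1 / 2). s < u x} \<in> lmeasurable" for s
        by (rule superlevel_lmeasurable[OF um]) simp
      define W where "W = measure lebesgue (ball (0 :: real^'n) (1 / 2))"
      have W: "W = V * (1 / 2) ^ n"
        unfolding W_def using content_ball[of "1/2" "0 :: real^'n"] unfolding n_eq by simp
      have \<mu>_anti: "\<mu> s' \<le> \<mu> s" if "s \<le> s'" for s s'
        unfolding \<mu>_def using that lm by (intro measure_mono_fmeasurable) (auto intro: fmeasurableD)
      have \<mu>_top: "\<mu> s \<le> W" for s
        unfolding \<mu>_def W_def using lm by (intro measure_mono_fmeasurable) (auto intro: fmeasurableD)
      have bound: "\<mu> t \<le> M' powr \<epsilon> * W * (m powr \<epsilon> * t powr (- \<epsilon>))" if m: "F + i < m" for m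
      proof -
        have m0: "0 < m" "F \<le> m" "i < m" using m F0 i0 by auto
        have "\<exists>x\<in>ball 0 (1/2). u x < m"
          using m0(3) u0 unfolding i_def by (subst (asm) cINF_less_iff) auto
        then obtain xs where "xs \<in> ball 0 (1/2)" "u xs < m" by blast
        then have xs: "norm xs \<le> 1 / 2" "u xs \<le> m" by simp_all
        have decay: "\<mu> (m * M' ^ k) \<le> q ^ k * W" for k
          unfolding \<mu>_def q_def W_def
        proof (rule superlevel_geometric_decay[OF um lsc M' d m0(1) xs, unfolded n_eq])
          fix z p :: "real^'n" and \<rho> s :: real
          assume "0 < \<rho>" "norm z + \<rho> \<le> 1 / 2" "norm (p - z) \<le> \<rho>" "m \<le> s" "u p \<le> s"
          then show "d * (V * \<rho> ^ n) \<le> measure lebesgue (cball z \<rho> \<inter> {x. u x \<le> M' * s})"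
            using low[OF flat lsc um u0[rule_format], of \<rho> z p s] m0 unfolding n_eq by simp
        qed
        show ?thesis
          by (rule geometric_decay_imp_power_decay[OF q M' m0(1) _ \<mu>_anti \<mu>_top decay t \<epsilon>_def])
            (use V W in simp)
      qed
      \<comment> \<open>The infimum over the ball need not be attained, and \<open>F + i\<close> may vanish, so the bound
        is passed to the limit from \<open>m > F + i\<close>.\<close>
      have "\<mu> t \<le> M' powr \<epsilon> * W * ((F + i) powr \<epsilon> * t powr (- \<epsilon>))"
      proof (rule tendsto_lowerbound)
        show "((\<lambda>m. M' powr \<epsilon> * W * (m powr \<epsilon> * t powr (- \<epsilon>)))
            \<longlongrightarrow> M' powr \<epsilon> * W * ((F + i) powr \<epsilon> * t powr (- \<epsilon>))) (at_right (F + i))"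
        proof (intro tendsto_intros tendsto_powr')
          have "\<forall>\<^sub>F m in at_right (F + i). F + i < m" by (rule eventually_at_right_less)
          then show "F + i \<noteq> 0 \<or> 0 < \<epsilon> \<and> (\<forall>\<^sub>F m in at_right (F + i). 0 \<le> m)"
            using \<epsilon> F0 i0 by (auto elim!: eventually_mono)
        qed
        show "\<forall>\<^sub>F m in at_right (F + i). \<mu> t \<le> M' powr \<epsilon> * W * (m powr \<epsilon> * t powr (- \<epsilon>))"
          using eventually_at_right_less by (rule eventually_mono) (rule bound)
      qed simp
      also have "W = 2 ^ n * (V * (1 / 4) ^ n)"
        unfolding W by (simp add: power_mult_distrib[symmetric])
      finally have \<mu>t: "\<mu> t \<le> C * (F + i) powr \<epsilon> * t powr (- \<epsilon>) * (V * (1 / 4) ^ n)"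
        unfolding C_def by (simp only: mult_ac)
      have "emeasure lebesgue ({x. u x > t} \<inter> ball 0 (1/4)) \<le> emeasure lebesgue {x \<in> ball 0 (1 / 2). t < u x}"
        using lm[of t] by (intro emeasure_mono) (auto intro: fmeasurableD)
      also have "\<dots> = ennreal (\<mu> t)" unfolding \<mu>_def by (rule emeasure_eq_measure2[OF lm])
      also have "\<dots> \<le> ennreal (C * (F + i) powr \<epsilon> * t powr (- \<epsilon>) * (V * (1 / 4) ^ n))"
        by (rule ennreal_leI[OF \<mu>t])
      finally have "emeasure lebesgue ({x. u x > t} \<inter> ball 0 (1/4)) / ennreal (V * (1 / 4) ^ n)
          \<le> ennreal (C * (F + i) powr \<epsilon> * t powr (- \<epsilon>) * (V * (1 / 4) ^ n)) / ennreal (V * (1 / 4) ^ n)"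
        by (rule divide_right_mono_ennreal)
      also have "\<dots> = ennreal (C * (F + i) powr \<epsilon> * t powr (- \<epsilon>))"
        using V C by (subst divide_ennreal) auto
      also have "\<dots> = ennreal C * ennreal ((F + i) powr \<epsilon>) * ennreal (t powr (- \<epsilon>))"
        using C by (simp add: ennreal_mult)
      also have "ennreal ((F + i) powr \<epsilon>) = ennreal_powr (sup_pos (ball 0 1) f + ennreal i) \<epsilon>"
        unfolding supF ennreal_powr_def using F0 i0 by (simp flip: ennreal_plus)
      finally show ?thesis
        using emeasure_lebesgue_ball[of "1/4" "0 :: real^'n"] unfolding n_eq i_def by simp
    qed
  qed
qed

end
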